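(* Set $t=q^{-1}$. For any $u\in S_n$, the interpolated stab polynomials $\mathrm{stab}_u(w)$, $w\in S_n$, are completely determined by the following properties (which they satisfy): (1) $\displaystyle \mathrm{stab}_u(uw_0)=(-1)^{\ell(u)}q^{\ell(uw_0)/2}\,r(\boldsymbol{x}_{(uw_0)^{-1}};\boldsymbol{x})\prod_{i+j\le n}\left(1-\frac{x_i}{y_{u(j)}}\right).$ (2) For any $w\in S_n$ and any simple reflection $s_i$ with $ws_i<w$, $\ \mathrm{stab}_u(ws_i)=M_i^u\,\mathrm{stab}_u(w).$
   Context: $s_i=(i,i+1)$, $w_0(i)=n+1-i$, $\ell$ the length, $<$ Bruhat order, products are compositions; $q^{1/2}$ is an indeterminate. For a vector $\boldsymbol{z}=(z_1,\dots,z_n)$ and $w\in S_n$, $\boldsymbol{z}_w=(z_{w(1)},\dots,z_{w(n)})$ and $\boldsymbol{z}^{-1}=(z_1^{-1},\dots,z_n^{-1})$. $\rho=(n-1,n-2,\dots,0)$; $S_n$ acts on $\mathbb{Z}^n$ by $w(e_i)=e_{w(i)}$; $\boldsymbol{x}^\mu=\prod x_i^{\mu_i}$; $\boldsymbol{x}^{\alpha_i}=x_i/x_{i+1}$. $s_i$ acts on functions of $(\boldsymbol{x};\boldsymbol{y})$ by exchanging $x_i,x_{i+1}$ (fixing $\boldsymbol{y}$). $r(\boldsymbol{x};\boldsymbol{y})=(-1)^{\ell(w_0)}\boldsymbol{x}^\rho\boldsymbol{y}^{-\rho}$. Operators: with $t=q^{-1}$, $$\overline\tau_i=\frac{t-1}{1-\boldsymbol{x}^{-\alpha_i}}+\frac{\boldsymbol{x}^{-\alpha_i}-t}{1-\boldsymbol{x}^{-\alpha_i}}s_i,\qquad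 M_i^u=q^{1/2}\,\boldsymbol{x}^{-w_0u^{-1}w_0\rho}\;\overline\tau_i\;\boldsymbol{x}^{w_0u^{-1}w_0\rho}$$ ($\overline\tau_i$ and hence $M_i^u$ are invertible). Interpolated stab polynomials: for $u,w\in S_n$, $$\mathrm{stab}_u(w)=(-1)^{\ell(uw_0)}q^{\ell(w_0)-\ell(w)/2}\,r(\boldsymbol{x}_{(uw_0)^{-1}};\boldsymbol{y}_u)\,Z^\square_{u,w}(\boldsymbol{x}^{-1};(\boldsymbol{y}_u)^{-1}).$$ Lattice model ($\square=(n,n-1,\dots,1)$): an $n\times n$ square grid with rows numbered $1,\dots,n$ from top to bottom and columns numbered $1,\dots,n$ from right to left; the vertex in row $i$, column $j$ has parameters $x=x_i$, $y=y_j$. Horizontal edges carry a spin in $\{+,1,\dots,n\}$ ($+$ = uncolored), vertical edges carry a subset of the color set $\{1<\dots<n\}$. The weight of a vertex with left spin $L$, top spin $\Sigma$, right spin $L'$, bottom spin $\Sigma'$, written $(L,\Sigma;L',\Sigma')$, is zero unless listed ($\Sigma_{>c},\Sigma_{<c},\Sigma_{(c,d)}$ denote the elements of $\Sigma$ that are $>c$, $<c$, strictly between $c$ and $d$): (1) $(+,\Sigma;+,\Sigma)$: $(-t)^{|\Sigma|}$. (2) $(c,\Sigma;c,\Sigma)$: $t^{|\Sigma_{>c}|}(-xy^{-1}+t^{\delta})$ with $\delta=1$ if $c\in\Sigma$, else $0$. (3) $(+,\Sigma;c,\Sigma\setminus\{c\})$, $c\in\Sigma$: $(-t)^{|\Sigma_{<c}|}t^{|\Sigma_{>c}|}$.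 (4) $(c,\Sigma;+,\Sigma\cup\{c\})$, $c\notin\Sigma$: $-(1-t)xy^{-1}(-t)^{|\Sigma_{>c}|}$. (5) $(c,\Sigma;d,(\Sigma\cup\{c\})\setminus\{d\})$, $c<d$, $d\in\Sigma$, $c\notin\Sigma$: $-(1-t)xy^{-1}(-t)^{|\Sigma_{(c,d)}|}t^{|\Sigma_{>d}|}$. (6) $(d,\Sigma;c,(\Sigma\cup\{d\})\setminus\{c\})$, $c<d$, $c\in\Sigma$, $d\notin\Sigma$: $-(1-t)(-1)^{|\Sigma_{(c,d)}|}t^{|\Sigma_{>d}|}$. $Z^\square_{\sigma,w}(\boldsymbol{x};\boldsymbol{y})$ is the partition function, i.e. the sum over all assignments of spins to interior edges of the product of the vertex weights, with boundary conditions: the top boundary edge in column $j$ carries the single color $\sigma(j)$; the right boundary edge in row $i$ has color $w(i)$; left and bottom boundary edges are uncolored. *)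

theory Defs
  imports
    "HOL-Library.Poly_Mapping"
    "HOL-Library.FuncSet"
    "HOL-Computational_Algebra.Fraction_Field"
    "HOL-Combinatorics.Permutations"
begin

section \<open>Symmetric group\<close>

text \<open>
  An element of \<open>S\<^sub>n\<close> is a function \<open>w\<close> with \<open>w permutes {1..n}\<close>; products are compositions.
\<close>

definition simple_refl :: "nat \<Rightarrow> nat \<Rightarrow> nat" where
  "simple_refl i = transpose i (Suc i)"

definition w0 :: "nat \<Rightarrow> nat \<Rightarrow> nat" where
  "w0 n i = (if i \<in> {1..n} then n + 1 - i else i)"

definition word_prod :: "nat list \<Rightarrow> nat \<Rightarrow> nat" where
  "word_prod is = foldr (\<lambda>i v. simple_refl i \<circ> v) is id"

definition perm_length :: "nat \<Rightarrow> (nat \<Rightarrow> nat) \<Rightarrow> nat" where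
  "perm_length n w = (LEAST k. \<exists>is. length is = k \<and> set is \<subseteq> {1..<n} \<and> word_prod is = w)"

inductive bruhat_less :: "nat \<Rightarrow> (nat \<Rightarrow> nat) \<Rightarrow> (nat \<Rightarrow> nat) \<Rightarrow> bool" for n :: nat where
  step: "v permutes {1..n} \<Longrightarrow> a \<in> {1..n} \<Longrightarrow> b \<in> {1..n} \<Longrightarrow> a \<noteq> b \<Longrightarrow>
    perm_length n v < perm_length n (v \<circ> transpose a b) \<Longrightarrow> bruhat_less n v (v \<circ> transpose a b)"
| trans: "bruhat_less n v v' \<Longrightarrow> bruhat_less n v' w \<Longrightarrow> bruhat_less n v w"

section \<open>Exponent vectors\<close>

definition rho :: "nat \<Rightarrow> nat \<Rightarrow> int" where
  "rho n i = int n - int i"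

text \<open>The action with \<open>w(e\<^sub>i) = e\<^bsub>w(i)\<^esub>\<close>; hence the inverse on coordinates.\<close>

definition perm_act :: "(nat \<Rightarrow> nat) \<Rightarrow> (nat \<Rightarrow> int) \<Rightarrow> nat \<Rightarrow> int" where
  "perm_act w \<mu> j = \<mu> (inv w j)"

definition monomial :: "nat \<Rightarrow> (nat \<Rightarrow> 'a::field) \<Rightarrow> (nat \<Rightarrow> int) \<Rightarrow> 'a" where
  "monomial n z \<mu> = (\<Prod>i\<in>{1..n}. z i powi \<mu> i)"

definition r_fun :: "nat \<Rightarrow> (nat \<Rightarrow> 'a::field) \<Rightarrow> (nat \<Rightarrow> 'a) \<Rightarrow> 'a" where
  "r_fun n x y = (- 1) ^ perm_length n (w0 n) * monomial n x (rho n) * monomial n y (\<lambda>i. - rho n i)"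

section \<open>Lattice model\<close>

text \<open>
  \<open>None\<close> is the uncolored horizontal spin. The arguments of \<open>vertex_weight\<close> after \<open>t x y\<close> are the
  left, top, right and bottom spins.
\<close>

definition vertex_weight ::
  "'a::field \<Rightarrow> 'a \<Rightarrow> 'a \<Rightarrow> nat option \<Rightarrow> nat set \<Rightarrow> nat option \<Rightarrow> nat set \<Rightarrow> 'a" where
  "vertex_weight t x y L S R S' =
    (case (L, R) of
      (None, None) \<Rightarrow>
        if S' = S then (- t) ^ card S else 0
    | (None, Some c) \<Rightarrow>
        if c \<in> S \<and> S' = S - {c}
        then (- t) ^ card {e \<in> S. e < c} * t ^ card {e \<in> S. e > c} else 0
    | (Some c, None) \<Rightarrow>
        if c \<notin> S \<and> S' = S \<union> {c}
        then - (1 - t) * (x / y) * (- t) ^ card {e \<in> S. e > c} else 0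
    | (Some c, Some d) \<Rightarrow>
        if c = d then
          if S' = S then t ^ card {e \<in> S. e > c} * (- (x / y) + (if c \<in> S then t else 1)) else 0
        else if d \<in> S \<and> c \<notin> S \<and> S' = (S \<union> {c}) - {d} then
          if c < d
          then - (1 - t) * (x / y) * (- t) ^ card {e \<in> S. c < e \<and> e < d} * t ^ card {e \<in> S. e > d}
          else - (1 - t) * (- 1) ^ card {e \<in> S. d < e \<and> e < c} * t ^ card {e \<in> S. e > c}
        else 0)"

text \<open>
  Columns are numbered from right to left. The vertex in row \<open>i\<close>, column \<open>j\<close> has left edge
  \<open>h (i, j)\<close>, right edge \<open>h (i, j - 1)\<close>, top edge \<open>v (i - 1, j)\<close> and bottom edge \<open>v (i, j)\<close>.
  So \<open>h (i, n)\<close>, \<open>h (i, 0)\<close>, \<open>v (0, j)\<close>, \<open>v (n, j)\<close> are the left, right, top and bottom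
  boundary edges.
\<close>

definition lattice_states ::
  "nat \<Rightarrow> (nat \<Rightarrow> nat) \<Rightarrow> (nat \<Rightarrow> nat) \<Rightarrow> ((nat \<times> nat \<Rightarrow> nat option) \<times> (nat \<times> nat \<Rightarrow> nat set)) set"
  where
  "lattice_states n \<sigma> w =
    {(h, v). h \<in> {1..n} \<times> {0..n} \<rightarrow>\<^sub>E insert None (Some ` {1..n}) \<and>
             v \<in> {0..n} \<times> {1..n} \<rightarrow>\<^sub>E Pow {1..n} \<and>
             (\<forall>j\<in>{1..n}. v (0, j) = {\<sigma> j} \<and> v (n, j) = {}) \<and>
             (\<forall>i\<in>{1..n}. h (i, n) = None \<and> h (i, 0) = Some (w i))}"

definition partition_fun ::
  "nat \<Rightarrow> 'a::field \<Rightarrow> (nat \<Rightarrow> nat) \<Rightarrow> (nat \<Rightarrow> nat) \<Rightarrow> (nat \<Rightarrow> 'a) \<Rightarrow> (nat \<Rightarrow> 'a) \<Rightarrow> 'a" where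
  "partition_fun n t \<sigma> w x y =
    (\<Sum>(h, v)\<in>lattice_states n \<sigma> w.
       \<Prod>(i, j)\<in>{1..n} \<times> {1..n}.
         vertex_weight t (x i) (y j) (h (i, j)) (v (i - 1, j)) (h (i, j - 1)) (v (i, j)))"

lemma finite_lattice_states: "finite (lattice_states n \<sigma> w)"
  by (rule finite_subset[of _ "({1..n} \<times> {0..n} \<rightarrow>\<^sub>E insert None (Some ` {1..n})) \<times>
                               ({0..n} \<times> {1..n} \<rightarrow>\<^sub>E Pow {1..n})"])
     (auto simp: lattice_states_def intro!: finite_PiE)

section \<open>The field of rational functions\<close>

datatype indet = IX nat | IY nat | IQ

text \<open>The linear order has no mathematical role; polynomial rings are integral domains only over
  linearly ordered indeterminates in \<open>Poly_Mapping\<close>.\<close>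

fun indet_code :: "indet \<Rightarrow> nat" where
  "indet_code (IX i) = 2 * i + 1"
| "indet_code (IY i) = 2 * i + 2"
| "indet_code IQ = 0"

lemma inj_indet_code: "indet_code a = indet_code b \<Longrightarrow> a = b"
  by (cases a; cases b) (auto, presburger+)

instantiation indet :: linorder
begin

definition "a \<le> b \<longleftrightarrow> indet_code a \<le> indet_code b"
definition "a < b \<longleftrightarrow> indet_code a < indet_code b"

instance
  by standard (auto simp: less_eq_indet_def less_indet_def intro: inj_indet_code)

end

type_synonym 'k mpoly = "(indet \<Rightarrow>\<^sub>0 nat) \<Rightarrow>\<^sub>0 'k"

text \<open>Rational functions in \<open>x\<^sub>i\<close>, \<open>y\<^sub>j\<close> (\<open>i, j\<close> natural numbers) and \<open>q\<^sup>1\<^sup>/\<^sup>2\<close> over the field \<open>'k\<close>.\<close>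

type_synonym 'k ratfun = "'k mpoly fract"

definition indet_poly :: "indet \<Rightarrow> 'k::field mpoly" where
  "indet_poly a = Poly_Mapping.single (Poly_Mapping.single a 1) 1"

definition xv :: "nat \<Rightarrow> 'k::field ratfun" where "xv i = Fract (indet_poly (IX i)) 1"
definition yv :: "nat \<Rightarrow> 'k::field ratfun" where "yv j = Fract (indet_poly (IY j)) 1"
definition qh :: "'k::field ratfun" where "qh = Fract (indet_poly IQ) 1"

text \<open>\<open>qh\<close> is the indeterminate \<open>q\<^sup>1\<^sup>/\<^sup>2\<close>, and \<open>tv\<close> is \<open>t = q\<^sup>-\<^sup>1\<close>.\<close>

definition qv :: "'k::field ratfun" where "qv = qh ^ 2"
definition tv :: "'k::field ratfun" where "tv = inverse qv"

subsection \<open>The action of simple reflections on the \<open>x\<close>-variables\<close>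

fun swap_indet :: "nat \<Rightarrow> indet \<Rightarrow> indet" where
  "swap_indet i (IX j) = IX (simple_refl i j)"
| "swap_indet i (IY j) = IY j"
| "swap_indet i IQ = IQ"

text \<open>\<open>map_key f\<close> is precomposition with \<open>f\<close>; since \<open>swap_indet i\<close> is an involution, this is the
  renaming of \<open>x\<^sub>i\<close> to \<open>x\<^bsub>i+1\<^esub>\<close> and conversely (see \<open>swap_ratfun_xv\<close> below).\<close>

definition swap_mpoly :: "nat \<Rightarrow> 'k::field mpoly \<Rightarrow> 'k mpoly" where
  "swap_mpoly i p = Poly_Mapping.map_key (Poly_Mapping.map_key (swap_indet i)) p"

lemma swap_indet_swap_indet [simp]: "swap_indet i (swap_indet i a) = a"
  by (cases a) (simp_all add: simple_refl_def)

lemma inj_swap_indet: "inj (swap_indet i)"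
  by (metis injI swap_indet_swap_indet)

lemma map_key_swap_indet_involution [simp]:
  "Poly_Mapping.map_key (swap_indet i) (Poly_Mapping.map_key (swap_indet i) m) = m"
  by (rule poly_mapping_eqI) (simp add: map_key.rep_eq inj_swap_indet)

lemma inj_map_key_swap_indet: "inj (Poly_Mapping.map_key (swap_indet i))"
  by (metis injI map_key_swap_indet_involution)

lemma swap_mpoly_add: "swap_mpoly i (p + q) = swap_mpoly i p + swap_mpoly i q"
  by (simp add: swap_mpoly_def map_key_plus inj_map_key_swap_indet)

lemma swap_mpoly_0 [simp]: "swap_mpoly i 0 = 0"
  by (simp add: swap_mpoly_def inj_map_key_swap_indet)

lemma swap_mpoly_single:
  "swap_mpoly i (Poly_Mapping.single m c) =
     Poly_Mapping.single (Poly_Mapping.map_key (swap_indet i) m) c"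
  using map_key_single[OF inj_map_key_swap_indet,
      of i "Poly_Mapping.map_key (swap_indet i) m" c]
  by (simp add: swap_mpoly_def)

lemma swap_mpoly_swap_mpoly [simp]: "swap_mpoly i (swap_mpoly i p) = p"
  by (rule poly_mapping_eqI) (simp add: swap_mpoly_def map_key.rep_eq inj_map_key_swap_indet)

lemma swap_mpoly_eq_0_iff [simp]: "swap_mpoly i p = 0 \<longleftrightarrow> p = 0"
  by (metis swap_mpoly_0 swap_mpoly_swap_mpoly)

lemma mpoly_single_induct [case_names zero single add]:
  fixes p :: "'a \<Rightarrow>\<^sub>0 'b::comm_monoid_add"
  assumes "P 0" "\<And>m c. P (Poly_Mapping.single m c)" "\<And>p q. P p \<Longrightarrow> P q \<Longrightarrow> P (p + q)"
  shows "P p"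
proof (induction p rule: update_induct)
  case (update f a b)
  have "Poly_Mapping.update a b f = Poly_Mapping.single a b + f"
    using update.hyps(1)
    by (intro poly_mapping_eqI)
       (auto simp: lookup_update lookup_add lookup_single in_keys_iff when_def)
  with update assms show ?case by simp
qed (use assms in simp)

lemma swap_mpoly_mult: "swap_mpoly i (p * q) = swap_mpoly i p * swap_mpoly i q"
proof (induction p rule: mpoly_single_induct)
  case (single m c)
  show ?case
    by (induction q rule: mpoly_single_induct)
       (simp_all add: mult_single swap_mpoly_single map_key_plus inj_swap_indet
          swap_mpoly_add distrib_left)
qed (simp_all add: swap_mpoly_add distrib_right)

lift_definition swap_ratfun :: "nat \<Rightarrow> 'k::field ratfun \<Rightarrow> 'k ratfun"
  is "\<lambda>i. map_prod (swap_mpoly i) (swap_mpoly i)"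
  by (auto simp flip: swap_mpoly_mult)

lemma swap_ratfun_Fract:
  "swap_ratfun i (Fract a b) = Fract (swap_mpoly i a) (swap_mpoly i b)"
  by transfer (auto simp: swap_mpoly_single[of _ 0 1, simplified])

lemma swap_mpoly_indet_poly: "swap_mpoly i (indet_poly a) = indet_poly (swap_indet i a)"
  using map_key_single[OF inj_swap_indet, of i "swap_indet i a" "1::nat"]
  by (simp add: indet_poly_def swap_mpoly_single)

lemma swap_mpoly_1 [simp]: "swap_mpoly i 1 = 1"
  using swap_mpoly_single[of i 0 1] by (simp add: inj_swap_indet)

lemma swap_ratfun_xv: "swap_ratfun i (xv j) = xv (simple_refl i j)"
  and swap_ratfun_yv: "swap_ratfun i (yv j) = yv j"
  and swap_ratfun_qh: "swap_ratfun i qh = qh"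
  by (simp_all add: xv_def yv_def qh_def swap_ratfun_Fract swap_mpoly_indet_poly)

lemma swap_ratfun_add: "swap_ratfun i (f + g) = swap_ratfun i f + swap_ratfun i g"
  by (cases f; cases g) (simp add: swap_ratfun_Fract swap_mpoly_add swap_mpoly_mult)

lemma swap_ratfun_mult: "swap_ratfun i (f * g) = swap_ratfun i f * swap_ratfun i g"
  by (cases f; cases g) (simp add: swap_ratfun_Fract swap_mpoly_mult)

section \<open>Operators and interpolated stab polynomials\<close>

definition tau_bar :: "nat \<Rightarrow> 'k::field ratfun \<Rightarrow> 'k ratfun" where
  "tau_bar i f =
    (let X = xv (Suc i) / xv i  \<comment> \<open>\<open>x\<^sup>-\<^sup>\<alpha>\<close> for \<open>\<alpha> = \<alpha>\<^sub>i\<close>\<close>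
     in (tv - 1) / (1 - X) * f + (X - tv) / (1 - X) * swap_ratfun i f)"

definition M_op :: "nat \<Rightarrow> (nat \<Rightarrow> nat) \<Rightarrow> nat \<Rightarrow> 'k::field ratfun \<Rightarrow> 'k ratfun" where
  "M_op n u i f =
    (let \<mu> = perm_act (w0 n \<circ> inv u \<circ> w0 n) (rho n)
     in qh * monomial n xv (\<lambda>j. - \<mu> j) * tau_bar i (monomial n xv \<mu> * f))"

text \<open>The power \<open>q\<^sup>\<ell>\<^sup>(\<^sup>w\<^sup>0\<^sup>)\<^sup>-\<^sup>\<ell>\<^sup>(\<^sup>w\<^sup>)\<^sup>/\<^sup>2\<close> is written as an integral power of \<open>q\<^sup>1\<^sup>/\<^sup>2\<close>, and
  \<open>z\<^sub>w\<close> as \<open>z \<circ> w\<close>.\<close>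

definition stab :: "nat \<Rightarrow> (nat \<Rightarrow> nat) \<Rightarrow> (nat \<Rightarrow> nat) \<Rightarrow> 'k::field ratfun" where
  "stab n u w =
    (- 1) ^ perm_length n (u \<circ> w0 n)
    * qh powi (2 * int (perm_length n (w0 n)) - int (perm_length n w))
    * r_fun n (xv \<circ> inv (u \<circ> w0 n)) (yv \<circ> u)
    * partition_fun n tv u w (\<lambda>i. inverse (xv i)) (\<lambda>j. inverse ((yv \<circ> u) j))"

end

theory Submission
  imports Defs
begin

text \<open>
  Both conditions are statements about one lattice model, and the equivalence splits into two
  evaluations of partition functions and a soft uniqueness argument.

  The recursion is a Yang--Baxter argument. Number the horizontal spins by \<open>0\<close> (uncolored) and
  \<open>1, \<dots>, n\<close>. In every configuration of nonzero weight a color occurs at most once in each horizontal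
  cut, so a spin never enters a vertex whose top edge already carries it; on such configurations the
  six kinds of weights are a single product: a factor depending only on the two horizontal spins,
  times a sign attached to the outgoing spin, times a power of \<open>- t\<close> attached to the incoming one
  (\<open>vertex_weight_spin\<close>). Consequently the exchange relation of two vertices with an R-matrix loses
  its dependence on the vertical spins except for membership, and becomes a finite check over the
  relative orders of four spins (\<open>pair_coeff_exchange_generic\<close>, \<open>adm_coeff_exchange\<close>). Moving the
  R-matrix through two adjacent rows from left to right (\<open>two_row_exchange\<close>) gives, because it acts
  on the left boundary by a scalar and on the right boundary by two terms, a three-term relation
  between partition functions (\<open>partition_fun_exchange\<close>). At \<open>x\<^sub>i\<^sup>-\<^sup>1\<close> this is precisely
  \<open>\<tau>\<^sub>i Z\<^sub>w = Z\<^bsub>w s\<^sub>i\<^esub>\<close> at a descent \<open>i\<close> of \<open>w\<close>. The conjugating monomial in the operator \<open>M\<^sub>i\<^sup>u\<close>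
  multiplies the \<open>x\<close>-monomial of the stab polynomial to \<open>(x\<^sub>1 \<dots> x\<^sub>n)\<^sup>n\<^sup>-\<^sup>1\<close>, which is symmetric and so
  passes through \<open>\<tau>\<^sub>i\<close> (\<open>stab_simple_refl\<close>).

  For \<open>w = u w\<^sub>0\<close> the model has a single state of nonzero weight: in each row the color that has to
  leave on the right is the leftmost color still present, so it must turn immediately and run
  straight through all other columns (\<open>partition_fun_reversed\<close>). Counting the factors \<open>t\<close> gives the
  inversions of \<open>u\<close>, and the product of the weights becomes the first condition (\<open>stab_reversed\<close>).

  Uniqueness: the operators \<open>M\<^sub>i\<^sup>u\<close> are injective because \<open>\<tau>\<^sub>i\<close> is (\<open>M_op_cancel\<close>), so the recursion
  propagates equality with the stab polynomials along \<open>w \<mapsto> w s\<^sub>i\<close> in both directions, up and down in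
  length, and these moves connect \<open>u w\<^sub>0\<close> with every permutation.
\<close>

section \<open>Vertex weights in uniform form\<close>

text \<open>
  Giving the uncolored spin the number \<open>0\<close>, below all colors, lets it take part in the comparisons that
  count colors, so that most case distinctions between colored and uncolored edges disappear.
\<close>

definition spin :: "nat \<Rightarrow> nat option" where
  "spin c = (if c = 0 then None else Some c)"

text \<open>
  The part of a vertex weight that depends only on the incoming spin \<open>a\<close>, the outgoing spin \<open>c\<close> and
  the spectral parameter \<open>z = x / y\<close>.
\<close>

definition vertex_factor :: "'a::field \<Rightarrow> 'a \<Rightarrow> nat \<Rightarrow> nat \<Rightarrow> 'a" where
  "vertex_factor t z a c =
    (if a = c then (if a = 0 then 1 else 1 - z)
     else if a = 0 then - 1 / t
     else if c = 0 then - (1 - t) * z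
     else if a < c then (1 - t) * z / t
     else - (1 - t))"

text \<open>
  An uncolored edge leaving a column carries no sign, hence the value \<open>1\<close> at \<open>0\<close>. The power of \<open>- t\<close>
  below counts all of \<open>S\<close> at \<open>0\<close>, which is the weight of an uncolored edge passing a column.
\<close>

definition sgn_above :: "nat set \<Rightarrow> nat \<Rightarrow> 'a::field" where
  "sgn_above S c = (if c = 0 then 1 else (- 1) ^ card {e \<in> S. c < e})"

definition pow_above :: "'a::field \<Rightarrow> nat set \<Rightarrow> nat \<Rightarrow> 'a" where
  "pow_above t S a = (- t) ^ card {e \<in> S. a < e}"

text \<open>
  The bottom spin forced by conservation of colors. Removing \<open>0\<close> as well makes one formula serve for
  uncolored spins; a color \<open>a = c \<notin> S\<close> leaves a set \<open>S\<close> of colors as it is.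
\<close>

definition move :: "nat set \<Rightarrow> nat \<Rightarrow> nat \<Rightarrow> nat set" where
  "move S a c = insert a S - {0, c}"

lemma card_split_at:
  fixes S :: "nat set"
  assumes "finite S" "c \<in> S"
  shows "card S = Suc (card {e \<in> S. e < c} + card {e \<in> S. c < e})"
proof -
  have "S = insert c ({e \<in> S. e < c} \<union> {e \<in> S. c < e})"
    using assms by auto
  moreover have "card \<dots> = Suc (card ({e \<in> S. e < c} \<union> {e \<in> S. c < e}))"
    using assms by (intro card_insert_disjoint) auto
  moreover have "card ({e \<in> S. e < c} \<union> {e \<in> S. c < e}) = card {e \<in> S. e < c} + card {e \<in> S. c < e}"
    using assms by (intro card_Un_disjoint) auto
  ultimately show ?thesis by argo
qed

lemma card_above_split:
  fixes S :: "nat set"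
  assumes "finite S" "a < c"
  shows "card {e \<in> S. a < e} =
    card {e \<in> S. a < e \<and> e < c} + card {e \<in> S. c < e} + (if c \<in> S then 1 else 0)"
proof -
  have "{e \<in> S. a < e} = {e \<in> S. a < e \<and> e < c} \<union> {e \<in> S. c < e} \<union> (if c \<in> S then {c} else {})"
    using assms by auto (metis linorder_neqE_nat)
  moreover have "card \<dots> = card ({e \<in> S. a < e \<and> e < c} \<union> {e \<in> S. c < e}) + card (if c \<in> S then {c} else {})"
    using assms by (intro card_Un_disjoint) (auto split: if_splits)
  moreover have "card ({e \<in> S. a < e \<and> e < c} \<union> {e \<in> S. c < e}) =
     card {e \<in> S. a < e \<and> e < c} + card {e \<in> S. c < e}"
    using assms by (intro card_Un_disjoint) auto
  ultimately show ?thesis by simp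
qed

lemma neg_one_power_mult_power: "(- 1) ^ k * (- t) ^ k = (t :: 'a::field) ^ k"
  by (simp flip: power_mult_distrib)

text \<open>
  The six families of weights look unrelated because each counts colors in another interval. Writing
  every interval count as a difference of counts above a spin, and \<open>(- t)\<^sup>k = (- 1)\<^sup>k t\<^sup>k\<close>, the powers
  of \<open>t\<close> belonging to the outgoing spin cancel up to a sign.
\<close>

lemma vertex_weight_spin:
  fixes t :: "'a::field"
  assumes "t \<noteq> 0" "finite S" "0 \<notin> S" "a \<notin> S"
  shows "vertex_weight t x y (spin a) S (spin c) S' =
    (if (c = a \<or> c = 0 \<or> c \<in> S) \<and> S' = move S a c
     then vertex_factor t (x / y) a c * sgn_above S c * pow_above t S a else 0)"
proof -
  have all: "{e \<in> S. 0 < e} = S" using assms(3) by (auto intro: gr0I)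
  consider "a = c" "a = 0" | "a = c" "0 < a" | "a = 0" "0 < c" | "c = 0" "0 < a"
    | "0 < a" "a < c" | "0 < c" "c < a"
    by (metis gr0I linorder_neqE_nat)
  then show ?thesis
  proof cases
    case 1
    then show ?thesis using assms
      by (auto simp: vertex_weight_def spin_def move_def vertex_factor_def sgn_above_def pow_above_def all)
  next
    case 2
    have "move S a c = S" using assms 2 by (auto simp: move_def)
    moreover have "vertex_factor t (x / y) a c * sgn_above S c * pow_above t S a
        = t ^ card {e \<in> S. c < e} * (- (x / y) + 1)"
      using 2 by (simp add: vertex_factor_def sgn_above_def pow_above_def mult.assoc neg_one_power_mult_power)
    ultimately show ?thesis using assms(4) 2
      by (simp add: vertex_weight_def spin_def)
  next
    case 3
    have "move S a c = S - {c}" using assms 3 by (auto simp: move_def)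
    moreover have "vertex_factor t (x / y) a c * sgn_above S c * pow_above t S a
        = (- t) ^ card {e \<in> S. e < c} * t ^ card {e \<in> S. c < e}" if "c \<in> S"
      using 3 assms(1) card_split_at[OF assms(2) that]
      by (simp add: vertex_factor_def sgn_above_def pow_above_def all power_add mult.left_commute[of "(- 1) ^ _"]
          neg_one_power_mult_power)
    ultimately show ?thesis using assms(4) 3
      by (simp add: vertex_weight_def spin_def)
  next
    case 4
    have "move S a c = S \<union> {a}" using assms 4 by (auto simp: move_def)
    then show ?thesis using assms(4) 4
      by (simp add: vertex_weight_def spin_def vertex_factor_def sgn_above_def pow_above_def)
  next
    case 5
    have "move S a c = S \<union> {a} - {c}" using assms 5 by (auto simp: move_def)
    moreover have "vertex_factor t (x / y) a c * sgn_above S c * pow_above t S a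
        = - (1 - t) * (x / y) * (- t) ^ card {e \<in> S. a < e \<and> e < c} * t ^ card {e \<in> S. c < e}"
      if "c \<in> S"
      using 5 assms(1) that card_above_split[OF assms(2), of a c]
      by (simp add: vertex_factor_def sgn_above_def pow_above_def power_add mult.left_commute[of "(- 1) ^ _"]
          neg_one_power_mult_power) (simp add: algebra_simps diff_divide_distrib)
    ultimately show ?thesis using assms(4) 5
      by (simp add: vertex_weight_def spin_def)
  next
    case 6
    have "move S a c = S \<union> {a} - {c}" using assms 6 by (auto simp: move_def)
    moreover have "vertex_factor t (x / y) a c * sgn_above S c * pow_above t S a
        = - (1 - t) * (- 1) ^ card {e \<in> S. c < e \<and> e < a} * t ^ card {e \<in> S. a < e}"
      using 6 assms card_above_split[OF assms(2), of c a]
      by (simp add: vertex_factor_def sgn_above_def pow_above_def power_add mult.left_commute[of "(- 1) ^ _"]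
          neg_one_power_mult_power mult.assoc)
    ultimately show ?thesis using assms(4) 6
      by (simp add: vertex_weight_def spin_def)
  qed
qed

section \<open>The R-matrix and the one-column exchange relation\<close>

text \<open>
  The entries of the R-matrix, for spectral parameters \<open>x\<close> and \<open>x'\<close>, that keep the pair of spins
  \<open>(a, b)\<close>, respectively turn it into \<open>(b, a)\<close>. The swapping entry vanishes for equal spins, so that such a pair is
  counted once.
\<close>

definition R_diag :: "'a::field \<Rightarrow> 'a \<Rightarrow> 'a \<Rightarrow> nat \<Rightarrow> nat \<Rightarrow> 'a" where
  "R_diag t x x' a b =
    (if a = b then (if a = 0 then x' - t * x else 0)
     else if b = 0 \<or> 0 < a \<and> a < b then (1 - t) * x' else (1 - t) * x)"

definition R_swap :: "'a::field \<Rightarrow> 'a \<Rightarrow> 'a \<Rightarrow> nat \<Rightarrow> nat \<Rightarrow> 'a" where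
  "R_swap t x x' a b = (if a = b then 0 else if a < b then x - x' else t * (x - x'))"

text \<open>
  Two vertices on top of each other, with horizontal spins \<open>a \<rightarrow> c\<close> in the upper and \<open>b \<rightarrow> d\<close> in the lower
  one. The sign and power factors of the lower vertex see the top spin after \<open>a\<close> was added and \<open>c\<close>
  removed; the last two factors are the resulting corrections, relative to the original top spin.
\<close>

definition pair_coeff :: "'a::field \<Rightarrow> 'a \<Rightarrow> 'a \<Rightarrow> nat \<Rightarrow> nat \<Rightarrow> nat \<Rightarrow> nat \<Rightarrow> 'a" where
  "pair_coeff t z z' a b c d = vertex_factor t z a c * vertex_factor t z' b d *
     ((if d \<noteq> 0 \<and> d < a then - 1 else 1) * (if d \<noteq> 0 \<and> d < c then - 1 else 1)) *
     ((if b < a then - t else 1) / (if b < c then - t else 1))"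

lemmas coeff_defs = pair_coeff_def vertex_factor_def R_diag_def R_swap_def

text \<open>
  All four terms refer to the same comparisons between \<open>0, a, b, c, d\<close>, so for each relative order
  the claim is an identity between rational functions in \<open>t, z, z'\<close>.
\<close>

lemma pair_coeff_exchange_generic:
  assumes t: "t \<noteq> 0"
    and ne: "a \<noteq> b" "c \<noteq> d" "c \<noteq> a" "d \<noteq> a" "c \<noteq> b" "d \<noteq> b"
  shows "R_diag t z z' a b * pair_coeff t z z' a b c d + R_swap t z z' a b * pair_coeff t z z' b a c d
      = R_diag t z z' c d * pair_coeff t z' z a b c d + R_swap t z z' d c * pair_coeff t z' z a b d c"
proof -
  consider "a = 0" | "b = 0" | "c = 0" | "d = 0" | "0 < a" "0 < b" "0 < c" "0 < d"
    by auto
  then show ?thesis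
  proof cases
    case 1
    from 1 ne show ?thesis
      apply (elim linorder_neqE_nat)
      apply (simp_all add: coeff_defs t)
      apply (simp_all add: divide_simps t)
      apply (simp_all add: algebra_simps)
      done
  next
    case 2
    from 2 ne show ?thesis
      apply (elim linorder_neqE_nat)
      apply (simp_all add: coeff_defs t)
      apply (simp_all add: divide_simps t)
      apply (simp_all add: algebra_simps)
      done
  next
    case 3
    from 3 ne show ?thesis
      apply (elim linorder_neqE_nat)
      apply (simp_all add: coeff_defs t)
      apply (simp_all add: divide_simps t)
      apply (simp_all add: algebra_simps)
      done
  next
    case 4
    from 4 ne show ?thesis
      apply (elim linorder_neqE_nat)
      apply (simp_all add: coeff_defs t)
      apply (simp_all add: divide_simps t)
      apply (simp_all add: algebra_simps)
      done
  next
    case 5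
    from 5 ne show ?thesis
      apply (elim linorder_neqE_nat)
      apply (simp_all add: coeff_defs t)
      apply (simp_all add: divide_simps t)
      apply (simp_all add: algebra_simps)
      done
  qed
qed

text \<open>
  Since the incoming spins are not in \<open>S\<close>, a vertex can only pass its spin on, become uncolored, or
  emit a color from its top edge; for the lower vertex that edge is the updated one.
\<close>

definition admissible :: "nat set \<Rightarrow> nat \<Rightarrow> nat \<Rightarrow> nat \<Rightarrow> nat \<Rightarrow> bool" where
  "admissible S a b c d \<longleftrightarrow>
     (c = a \<or> c = 0 \<or> c \<in> S) \<and> (d = b \<or> d = 0 \<or> d \<in> move S a c)"

definition adm_coeff :: "'a::field \<Rightarrow> 'a \<Rightarrow> 'a \<Rightarrow> nat set \<Rightarrow> nat \<Rightarrow> nat \<Rightarrow> nat \<Rightarrow> nat \<Rightarrow> 'a" where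
  "adm_coeff t z z' S a b c d = (if admissible S a b c d then pair_coeff t z z' a b c d else 0)"

text \<open>
  The Yang--Baxter equation for one column, with the common factors of the vertical spins removed.
  If the four spins are distinct, all four terms are admissible under the same condition and the
  generic identity applies. Each coincidence leaves an identity in at most three spins; which of its
  terms are admissible then depends on the spins that coincide.
\<close>

lemma adm_coeff_exchange:
  assumes t: "t \<noteq> 0" and S: "0 \<notin> S" "a \<notin> S" "b \<notin> S" and ab: "a = b \<Longrightarrow> a = 0"
  shows "R_diag t z z' a b * adm_coeff t z z' S a b c d + R_swap t z z' a b * adm_coeff t z z' S b a c d
      = R_diag t z z' c d * adm_coeff t z' z S a b c d + R_swap t z z' d c * adm_coeff t z' z S a b d c"
proof -
  note defs = adm_coeff_def admissible_def move_def coeff_defs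
  consider "a = b" | "a \<noteq> b" "c = d" | "a \<noteq> b" "c \<noteq> d" "c = a" | "a \<noteq> b" "c \<noteq> d" "c = b"
    | "a \<noteq> b" "c \<noteq> d" "d = a" | "a \<noteq> b" "c \<noteq> d" "d = b"
    | "a \<noteq> b" "c \<noteq> d" "c \<noteq> a" "d \<noteq> a" "c \<noteq> b" "d \<noteq> b"
    by metis
  then show ?thesis
  proof cases
    case 1
    then have "a = 0" "b = 0" using ab by auto
    show ?thesis
    proof (cases "c = d")
      case True
      then show ?thesis using t S \<open>a = 0\<close> \<open>b = 0\<close> by (auto simp: defs)
    next
      case False
      from t S False show ?thesis
        apply (cases "c = 0"; cases "d = 0")
        apply (elim linorder_neqE_nat)
        apply (simp_all add: defs \<open>a = 0\<close> \<open>b = 0\<close>)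
        apply (simp_all add: divide_simps)?
        apply (auto simp: algebra_simps)?
        done
    qed
  next
    case 2
    then show ?thesis using t S by (auto simp: defs) (auto simp: field_simps)
  next
    case 3
    show ?thesis
    proof (cases "d \<in> {a, b}")
      case True
      then show ?thesis using 3 t S
        apply (elim linorder_neqE_nat)
        apply (auto simp: defs)
        apply (simp_all add: divide_simps)?
        apply (auto simp: algebra_simps)?
        done
    next
      case False
      then have ne: "d \<noteq> a" "d \<noteq> b" by auto
      show ?thesis
      proof (cases "d = 0 \<or> d \<in> S")
        case True
        from 3 ne True show ?thesis using t S
          apply (elim linorder_neqE_nat)
          apply (simp_all add: defs)
          apply (simp_all add: divide_simps)?
          apply (auto simp: algebra_simps)?
          done
      next
        case False
        with 3 ne show ?thesis using t S by (auto simp: defs)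
      qed
    qed
  next
    case 4
    show ?thesis
    proof (cases "d \<in> {a, b}")
      case True
      then show ?thesis using 4 t S
        apply (elim linorder_neqE_nat)
        apply (auto simp: defs)
        apply (simp_all add: divide_simps)?
        apply (auto simp: algebra_simps)?
        done
    next
      case False
      then have ne: "d \<noteq> a" "d \<noteq> b" by auto
      show ?thesis
      proof (cases "d = 0 \<or> d \<in> S")
        case True
        from 4 ne True show ?thesis using t S
          apply (elim linorder_neqE_nat)
          apply (simp_all add: defs)
          apply (simp_all add: divide_simps)?
          apply (auto simp: algebra_simps)?
          done
      next
        case False
        with 4 ne show ?thesis using t S by (auto simp: defs)
      qed
    qed
  next
    case 5
    show ?thesis
    proof (cases "c \<in> {a, b}")
      case True
      then show ?thesis using 5 t S
        apply (elim linorder_neqE_nat)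
        apply (auto simp: defs)
        apply (simp_all add: divide_simps)?
        apply (auto simp: algebra_simps)?
        done
    next
      case False
      then have ne: "c \<noteq> a" "c \<noteq> b" by auto
      show ?thesis
      proof (cases "c = 0 \<or> c \<in> S")
        case True
        from 5 ne True show ?thesis using t S
          apply (elim linorder_neqE_nat)
          apply (simp_all add: defs)
          apply (simp_all add: divide_simps)?
          apply (auto simp: algebra_simps)?
          done
      next
        case False
        with 5 ne show ?thesis using t S by (auto simp: defs)
      qed
    qed
  next
    case 6
    show ?thesis
    proof (cases "c \<in> {a, b}")
      case True
      then show ?thesis using 6 t S
        apply (elim linorder_neqE_nat)
        apply (auto simp: defs)
        apply (simp_all add: divide_simps)?
        apply (auto simp: algebra_simps)?
        done
    next
      case False
      then have ne: "c \<noteq> a" "c \<noteq> b" by auto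
      show ?thesis
      proof (cases "c = 0 \<or> c \<in> S")
        case True
        from 6 ne True show ?thesis using t S
          apply (elim linorder_neqE_nat)
          apply (simp_all add: defs)
          apply (simp_all add: divide_simps)?
          apply (auto simp: algebra_simps)?
          done
      next
        case False
        with 6 ne show ?thesis using t S by (auto simp: defs)
      qed
    qed
  next
    case 7
    have A: "admissible S a b c d \<longleftrightarrow> (c = 0 \<or> c \<in> S) \<and> (d = 0 \<or> d \<in> S)"
      "admissible S b a c d \<longleftrightarrow> (c = 0 \<or> c \<in> S) \<and> (d = 0 \<or> d \<in> S)"
      "admissible S a b d c \<longleftrightarrow> (c = 0 \<or> c \<in> S) \<and> (d = 0 \<or> d \<in> S)"
      using 7 S by (auto simp: admissible_def move_def)
    show ?thesis
      using pair_coeff_exchange_generic[OF t 7, of z z'] by (simp add: adm_coeff_def A)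
  qed
qed

section \<open>The exchange relation for two rows\<close>

text \<open>
  Stated additively, to avoid subtraction of natural numbers.
\<close>

lemma card_above_move:
  assumes "finite S" "0 \<notin> S" "a \<notin> S" "c = a \<or> c = 0 \<or> c \<in> S"
  shows "card {e \<in> move S a c. d < e} + (if d < c then 1 else 0)
       = card {e \<in> S. d < e} + (if d < a then 1 else 0)"
proof -
  have ins: "card {e \<in> insert a S. d < e} = card {e \<in> S. d < e} + (if d < a then 1 else 0)"
  proof (cases "d < a")
    case True
    then have "{e \<in> insert a S. d < e} = insert a {e \<in> S. d < e}" by auto
    then show ?thesis using assms True by simp
  next
    case False
    then have "{e \<in> insert a S. d < e} = {e \<in> S. d < e}" by auto
    then show ?thesis using False by simp
  qed
  have "card {e \<in> move S a c. d < e} + (if d < c then 1 else 0) = card {e \<in> insert a S. d < e}"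
  proof (cases "d < c")
    case True
    then have "{e \<in> insert a S. d < e} = insert c {e \<in> move S a c. d < e}"
      using assms by (auto simp: move_def)
    moreover have "c \<notin> {e \<in> move S a c. d < e}" by (auto simp: move_def)
    moreover have "finite {e \<in> move S a c. d < e}" using assms(1) by (auto simp: move_def)
    ultimately show ?thesis using True by simp
  next
    case False
    then have "{e \<in> insert a S. d < e} = {e \<in> move S a c. d < e}"
      by (auto simp: move_def)
    then show ?thesis using False by simp
  qed
  with ins show ?thesis by simp
qed

lemma sgn_above_move:
  assumes "finite S" "0 \<notin> S" "a \<notin> S" "c = a \<or> c = 0 \<or> c \<in> S"
  shows "sgn_above (move S a c) d = (sgn_above S d :: 'a::field) *
    ((if d \<noteq> 0 \<and> d < a then - 1 else 1) * (if d \<noteq> 0 \<and> d < c then - 1 else 1))"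
proof (cases "d = 0")
  case False
  have "(- 1 :: 'a) ^ card {e \<in> move S a c. d < e} * (if d < c then - 1 else 1)
      = (- 1) ^ (card {e \<in> move S a c. d < e} + (if d < c then 1 else 0))"
    by simp
  also have "\<dots> = (- 1) ^ card {e \<in> S. d < e} * (if d < a then - 1 else 1)"
    by (simp add: card_above_move[OF assms])
  finally have *: "(- 1 :: 'a) ^ card {e \<in> move S a c. d < e} * (if d < c then - 1 else 1)
      = (- 1) ^ card {e \<in> S. d < e} * (if d < a then - 1 else 1)" .
  have "(- 1 :: 'a) ^ card {e \<in> move S a c. d < e}
      = ((- 1) ^ card {e \<in> move S a c. d < e} * (if d < c then - 1 else 1)) * (if d < c then - 1 else 1)"
    by simp
  then show ?thesis unfolding * using False by (simp add: sgn_above_def)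
qed (simp add: sgn_above_def)

lemma pow_above_move:
  assumes "finite S" "0 \<notin> S" "a \<notin> S" "c = a \<or> c = 0 \<or> c \<in> S" "(t :: 'a::field) \<noteq> 0"
  shows "pow_above t (move S a c) b
    = pow_above t S b * ((if b < a then - t else 1) / (if b < c then - t else 1))"
proof -
  have "pow_above t (move S a c) b * (if b < c then - t else 1)
      = (- t) ^ (card {e \<in> move S a c. b < e} + (if b < c then 1 else 0))"
    by (simp add: pow_above_def)
  also have "\<dots> = pow_above t S b * (if b < a then - t else 1)"
    by (simp add: card_above_move[OF assms(1-4)] pow_above_def)
  finally show ?thesis using assms(5) by (auto simp: field_simps split: if_splits)
qed

text \<open>
  The sum runs over the vertical spin of the inner edge; conservation leaves at most one nonzero term.
\<close>

definition column_pair ::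
  "nat \<Rightarrow> 'a::field \<Rightarrow> 'a \<Rightarrow> 'a \<Rightarrow> 'a \<Rightarrow> nat \<Rightarrow> nat \<Rightarrow> nat set \<Rightarrow> nat \<Rightarrow> nat \<Rightarrow> nat set \<Rightarrow> 'a" where
  "column_pair n t x x' y a b S c d S' =
    (\<Sum>s\<in>Pow {1..n}. vertex_weight t x y (spin a) S (spin c) s
                    * vertex_weight t x' y (spin b) s (spin d) S')"

text \<open>
  The final bottom spin and the product of signs and powers are symmetric under exchanging the two left
  spins and under exchanging the two right spins. Hence they are a common factor of all terms of the
  exchange relation.
\<close>

lemma column_pair_eq:
  fixes t :: "'a::field"
  assumes t: "t \<noteq> 0" and S: "S \<subseteq> {1..n}" and ab: "a \<le> n" "a \<notin> S" "b \<notin> S" "a = b \<Longrightarrow> a = 0"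
  shows "column_pair n t x x' y a b S c d S' =
    (if S' = insert a (insert b S) - {0, c, d}
     then adm_coeff t (x / y) (x' / y) S a b c d
       * (sgn_above S c * sgn_above S d * pow_above t S a * pow_above t S b) else 0)"
proof (cases "c = a \<or> c = 0 \<or> c \<in> S")
  case False
  have fin: "finite S" and S0: "0 \<notin> S" using S by (auto intro: finite_subset)
  from False show ?thesis
    by (simp add: column_pair_def vertex_weight_spin[OF t fin S0 ab(2)] adm_coeff_def admissible_def)
next
  case True
  have fin: "finite S" and S0: "0 \<notin> S" using S by (auto intro: finite_subset)
  have mv: "move S a c \<in> Pow {1..n}" using S ab(1) by (auto simp: move_def)
  then have fin': "finite (move S a c)" and S0': "0 \<notin> move S a c" and b': "b \<notin> move S a c"
    using ab by (auto simp: move_def fin)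
  have "column_pair n t x x' y a b S c d S' =
     (\<Sum>s\<in>Pow {1..n}. if s = move S a c then vertex_factor t (x / y) a c * sgn_above S c * pow_above t S a
         * vertex_weight t x' y (spin b) (move S a c) (spin d) S' else 0)"
    unfolding column_pair_def
    by (intro sum.cong) (auto simp: vertex_weight_spin[OF t fin S0 ab(2)] True)
  also have "\<dots> = vertex_factor t (x / y) a c * sgn_above S c * pow_above t S a
         * vertex_weight t x' y (spin b) (move S a c) (spin d) S'"
    using mv by (simp add: sum.delta)
  also have "\<dots> = (if (d = b \<or> d = 0 \<or> d \<in> move S a c) \<and> S' = move (move S a c) b d
     then adm_coeff t (x / y) (x' / y) S a b c d
       * (sgn_above S c * sgn_above S d * pow_above t S a * pow_above t S b) else 0)"
    using True by (simp add: vertex_weight_spin[OF t fin' S0' b'] sgn_above_move[OF fin S0 ab(2) True]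
      pow_above_move[OF fin S0 ab(2) True t] adm_coeff_def admissible_def pair_coeff_def)
  also have "move (move S a c) b d = insert a (insert b S) - {0, c, d}"
    using True ab S0 by (auto simp: move_def)
  also have "(if (d = b \<or> d = 0 \<or> d \<in> move S a c) \<and> S' = insert a (insert b S) - {0, c, d}
     then adm_coeff t (x / y) (x' / y) S a b c d
       * (sgn_above S c * sgn_above S d * pow_above t S a * pow_above t S b) else 0) =
    (if S' = insert a (insert b S) - {0, c, d}
     then adm_coeff t (x / y) (x' / y) S a b c d
       * (sgn_above S c * sgn_above S d * pow_above t S a * pow_above t S b) else 0)"
    by (auto simp: adm_coeff_def admissible_def)
  finally show ?thesis .
qed

text \<open>
  The R-matrix is homogeneous of degree one in \<open>(x, x')\<close>, so its entries at \<open>(x, x')\<close> and at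
  \<open>(x / y, x' / y)\<close> differ by the factor \<open>y\<close>; this is what makes one R-matrix serve all columns.
\<close>

lemma column_pair_exchange:
  fixes t :: "'a::field"
  assumes t: "t \<noteq> 0" and y: "y \<noteq> 0" and S: "S \<subseteq> {1..n}"
    and ab: "a \<le> n" "b \<le> n" "a \<notin> S" "b \<notin> S" "a = b \<Longrightarrow> a = 0"
  shows "R_diag t x x' a b * column_pair n t x x' y a b S c d S'
       + R_swap t x x' a b * column_pair n t x x' y b a S c d S'
       = R_diag t x x' c d * column_pair n t x' x y a b S c d S'
       + R_swap t x x' d c * column_pair n t x' x y a b S d c S'"
proof -
  define z z' where "z = x / y" and "z' = x' / y"
  define K where "K = (sgn_above S c * sgn_above S d * pow_above t S a * pow_above t S b)"
  have S0: "0 \<notin> S" using S by auto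
  have R: "R_diag t x x' i j = y * R_diag t z z' i j" "R_swap t x x' i j = y * R_swap t z z' i j" for i j
    using y by (simp_all add: R_diag_def R_swap_def z_def z'_def field_simps)
  have ba: "b = a \<Longrightarrow> b = 0" using ab(5) by auto
  note eqs = column_pair_eq[OF t S ab(1,3,4,5)] column_pair_eq[OF t S ab(2,4,3) ba]
  show ?thesis
  proof (cases "S' = insert a (insert b S) - {0, c, d}")
    case True
    then have "S' = insert b (insert a S) - {0, c, d}" "S' = insert a (insert b S) - {0, d, c}"
      by auto
    with True have
      "column_pair n t x x' y a b S c d S' = adm_coeff t z z' S a b c d * K"
      "column_pair n t x x' y b a S c d S' = adm_coeff t z z' S b a c d * K"
      "column_pair n t x' x y a b S c d S' = adm_coeff t z' z S a b c d * K"
      "column_pair n t x' x y a b S d c S' = adm_coeff t z' z S a b d c * K"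
      by (simp_all add: eqs K_def z_def z'_def mult_ac)
    moreover have "y * K * (R_diag t z z' a b * adm_coeff t z z' S a b c d
            + R_swap t z z' a b * adm_coeff t z z' S b a c d)
      = y * K * (R_diag t z z' c d * adm_coeff t z' z S a b c d
            + R_swap t z z' d c * adm_coeff t z' z S a b d c)"
      by (simp add: adm_coeff_exchange[OF t S0 ab(3,4,5), where z = z and z' = z'])
    ultimately show ?thesis by (simp add: R algebra_simps)
  next
    case False
    then have "S' \<noteq> insert b (insert a S) - {0, c, d}" "S' \<noteq> insert a (insert b S) - {0, d, c}"
      by auto
    with False show ?thesis by (simp add: eqs)
  qed
qed

text \<open>
  This carries the invariant ``the two spins are distinct or uncolored, and do not sit in the columns
  further right'' from one column to the next.
\<close>

lemma column_pair_nonzeroD: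
  fixes t :: "'a::field"
  assumes t: "t \<noteq> 0" and S: "S \<subseteq> {1..n}" and ab: "a \<le> n" "a \<notin> S" "b \<notin> S" "a = b \<Longrightarrow> a = 0"
    and nz: "column_pair n t x x' y a b S c d S' \<noteq> 0"
  shows "c \<in> {0, a, b} \<union> S" "d \<in> {0, a, b} \<union> S" "c = d \<Longrightarrow> c = 0"
proof -
  have "admissible S a b c d"
    using nz by (auto simp: column_pair_eq[OF t S ab] adm_coeff_def split: if_splits)
  then show "c \<in> {0, a, b} \<union> S" "d \<in> {0, a, b} \<union> S" "c = d \<Longrightarrow> c = 0"
    using ab S by (auto simp: admissible_def move_def)
qed

text \<open>
  The one-row partition function of the columns \<open>j, \<dots>, 1\<close>, read from left to right, with left spin
  \<open>a\<close> and right spin \<open>c\<close>; \<open>T\<close> and \<open>B\<close> are the top and bottom spins of the columns.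
\<close>

fun row_weight :: "nat \<Rightarrow> 'a::field \<Rightarrow> 'a \<Rightarrow> (nat \<Rightarrow> 'a) \<Rightarrow> (nat \<Rightarrow> nat set) \<Rightarrow> (nat \<Rightarrow> nat set)
    \<Rightarrow> nat \<Rightarrow> nat \<Rightarrow> nat \<Rightarrow> 'a" where
  "row_weight n t x y T B 0 a c = (if a = c then 1 else 0)"
| "row_weight n t x y T B (Suc j) a c =
    (\<Sum>m\<le>n. vertex_weight t x (y (Suc j)) (spin a) (T (Suc j)) (spin m) (B (Suc j))
          * row_weight n t x y T B j m c)"

lemma row_weight_cong:
  "(\<And>k. k \<in> {1..j} \<Longrightarrow> T k = T' k \<and> B k = B' k) \<Longrightarrow>
    row_weight n t x y T B j a c = row_weight n t x y T' B' j a c"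
  by (induction j arbitrary: a) (auto intro!: sum.cong)

lemma sum_PiE_insert:
  assumes "i \<notin> A"
  shows "(\<Sum>f\<in>Pi\<^sub>E (insert i A) B. g f) = (\<Sum>b\<in>B i. \<Sum>f\<in>Pi\<^sub>E A B. g (f(i := b)))"
proof -
  have "(\<Sum>f\<in>Pi\<^sub>E (insert i A) B. g f) = (\<Sum>(b, f)\<in>B i \<times> Pi\<^sub>E A B. g (f(i := b)))"
    unfolding PiE_insert_eq
    by (subst sum.reindex[OF inj_combinator[OF assms]]) (simp add: case_prod_unfold comp_def)
  also have "\<dots> = (\<Sum>b\<in>B i. \<Sum>f\<in>Pi\<^sub>E A B. g (f(i := b)))"
    by (simp add: sum.cartesian_product)
  finally show ?thesis .
qed

text \<open>
  The vertical spins between the two rows are summed over.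
\<close>

definition two_row :: "nat \<Rightarrow> 'a::field \<Rightarrow> 'a \<Rightarrow> 'a \<Rightarrow> (nat \<Rightarrow> 'a) \<Rightarrow> (nat \<Rightarrow> nat set) \<Rightarrow> (nat \<Rightarrow> nat set)
    \<Rightarrow> nat \<Rightarrow> nat \<Rightarrow> nat \<Rightarrow> nat \<Rightarrow> nat \<Rightarrow> 'a" where
  "two_row n t x x' y T B j a b c d =
    (\<Sum>m\<in>{1..j} \<rightarrow>\<^sub>E Pow {1..n}. row_weight n t x y T m j a c * row_weight n t x' y m B j b d)"

lemma two_row_0: "two_row n t x x' y T B 0 a b c d = (if a = c \<and> b = d then 1 else 0)"
  by (simp add: two_row_def)

text \<open>
  The inner vertical spin of the leftmost column can be summed first, because the other columns do not
  see it.
\<close>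

lemma two_row_Suc:
  "two_row n t x x' y T B (Suc j) a b c d =
    (\<Sum>p\<le>n. \<Sum>r\<le>n. column_pair n t x x' (y (Suc j)) a b (T (Suc j)) p r (B (Suc j))
                     * two_row n t x x' y T B j p r c d)"
proof -
  let ?F = "{1..j} \<rightarrow>\<^sub>E Pow {1..n}"
  let ?u = "\<lambda>p s. vertex_weight t x (y (Suc j)) (spin a) (T (Suc j)) (spin p) s"
  let ?v = "\<lambda>r s. vertex_weight t x' (y (Suc j)) (spin b) s (spin r) (B (Suc j))"
  let ?f = "\<lambda>p m. row_weight n t x y T m j p c"
  let ?g = "\<lambda>r m. row_weight n t x' y m B j r d"
  have ins: "{1..Suc j} = insert (Suc j) {1..j}" by auto
  have upd: "row_weight n t x y T (m(Suc j := s)) j p c = ?f p m"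
    "row_weight n t x' y (m(Suc j := s)) B j r d = ?g r m" for m s p r
    by (auto intro!: row_weight_cong)
  have "two_row n t x x' y T B (Suc j) a b c d =
    (\<Sum>s\<in>Pow {1..n}. \<Sum>m\<in>?F. (\<Sum>p\<le>n. ?u p s * ?f p m) * (\<Sum>r\<le>n. ?v r s * ?g r m))"
    unfolding two_row_def ins by (subst sum_PiE_insert) (simp_all add: upd)
  also have "\<dots> = (\<Sum>s\<in>Pow {1..n}. \<Sum>m\<in>?F. \<Sum>p\<le>n. \<Sum>r\<le>n. ?u p s * ?v r s * (?f p m * ?g r m))"
    by (simp add: sum_product mult_ac)
  also have "\<dots> = (\<Sum>s\<in>Pow {1..n}. \<Sum>p\<le>n. \<Sum>m\<in>?F. \<Sum>r\<le>n. ?u p s * ?v r s * (?f p m * ?g r m))"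
    by (rule sum.cong[OF refl], rule sum.swap)
  also have "\<dots> = (\<Sum>p\<le>n. \<Sum>s\<in>Pow {1..n}. \<Sum>m\<in>?F. \<Sum>r\<le>n. ?u p s * ?v r s * (?f p m * ?g r m))"
    by (rule sum.swap)
  also have "\<dots> = (\<Sum>p\<le>n. \<Sum>s\<in>Pow {1..n}. \<Sum>r\<le>n. \<Sum>m\<in>?F. ?u p s * ?v r s * (?f p m * ?g r m))"
    by (rule sum.cong[OF refl], rule sum.cong[OF refl], rule sum.swap)
  also have "\<dots> = (\<Sum>p\<le>n. \<Sum>r\<le>n. \<Sum>s\<in>Pow {1..n}. \<Sum>m\<in>?F. ?u p s * ?v r s * (?f p m * ?g r m))"
    by (rule sum.cong[OF refl], rule sum.swap)
  also have "\<dots> = (\<Sum>p\<le>n. \<Sum>r\<le>n. column_pair n t x x' (y (Suc j)) a b (T (Suc j)) p r (B (Suc j))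
                     * two_row n t x x' y T B j p r c d)"
    by (simp add: column_pair_def two_row_def sum_product)
  finally show ?thesis .
qed

text \<open>
  The train argument: the R-matrix on the left of a column is exchanged with it and then stands on the
  left of the remaining columns.
\<close>

lemma two_row_exchange:
  fixes t :: "'a::field"
  assumes t: "t \<noteq> 0" and y: "\<And>k. k \<in> {1..j} \<Longrightarrow> y k \<noteq> 0"
    and T: "\<And>k. k \<in> {1..j} \<Longrightarrow> T k \<subseteq> {1..n}"
    and disj: "\<And>k l. k \<in> {1..j} \<Longrightarrow> l \<in> {1..j} \<Longrightarrow> k \<noteq> l \<Longrightarrow> T k \<inter> T l = {}"
    and ab: "a \<le> n" "b \<le> n" "a = b \<Longrightarrow> a = 0" "\<And>k. k \<in> {1..j} \<Longrightarrow> a \<notin> T k \<and> b \<notin> T k"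
  shows "R_diag t x x' a b * two_row n t x x' y T B j a b c d
       + R_swap t x x' a b * two_row n t x x' y T B j b a c d
       = R_diag t x x' c d * two_row n t x' x y T B j a b c d
       + R_swap t x x' d c * two_row n t x' x y T B j a b d c"
  using y T disj ab
proof (induction j arbitrary: a b)
  case 0
  have E: "two_row n t x x' y T B 0 a b c d = of_bool (a = c \<and> b = d)" for x x' a b c d
    by (simp add: two_row_0)
  have "b = c \<and> a = d \<longleftrightarrow> a = d \<and> b = c" by (rule conj_commute)
  then have "two_row n t x x' y T B 0 b a c d = of_bool (a = d \<and> b = c)"
    by (simp only: E)
  moreover have "R_diag t x x' a b * of_bool (a = c \<and> b = d) = R_diag t x x' c d * of_bool (a = c \<and> b = d)"
    by (cases "a = c \<and> b = d") (simp_all only: simp_thms of_bool_eq mult_zero_right)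
  moreover have "R_swap t x x' a b * of_bool (a = d \<and> b = c) = R_swap t x x' d c * of_bool (a = d \<and> b = c)"
    by (cases "a = d \<and> b = c") (simp_all only: simp_thms of_bool_eq mult_zero_right)
  ultimately show ?case by (simp only: E)
next
  case (Suc j)
  let ?C = "\<lambda>x x' a b p r. column_pair n t x x' (y (Suc j)) a b (T (Suc j)) p r (B (Suc j))"
  let ?D = "\<lambda>x x' p r c d. two_row n t x x' y T B j p r c d"
  have top: "T (Suc j) \<subseteq> {1..n}" "y (Suc j) \<noteq> 0" "a \<notin> T (Suc j)" "b \<notin> T (Suc j)"
    using Suc.prems(1,2,7)[of "Suc j"] by simp_all
  have IH: "?C x' x a b p r * (R_diag t x x' p r * ?D x x' p r c d + R_swap t x x' p r * ?D x x' r p c d)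
      = ?C x' x a b p r * (R_diag t x x' c d * ?D x' x p r c d + R_swap t x x' d c * ?D x' x p r d c)"
    for p r
  proof (cases "?C x' x a b p r = 0")
    case False
    note C = column_pair_nonzeroD[OF t top(1) Suc.prems(4) top(3,4) Suc.prems(6) False]
    have le: "p \<le> n" "r \<le> n"
      using C(1,2) Suc.prems(4,5) top(1) by (auto simp: subset_iff)
    have notin: "p \<notin> T k \<and> r \<notin> T k" if k: "k \<in> {1..j}" for k
    proof -
      have "k \<in> {1..Suc j}" "Suc j \<in> {1..Suc j}" "k \<noteq> Suc j" using k by simp_all
      then have "T k \<inter> T (Suc j) = {}" "T k \<subseteq> {1..n}" "a \<notin> T k \<and> b \<notin> T k"
        using Suc.prems(2,3,7) by blast+
      then show ?thesis using C(1,2) by auto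
    qed
    have less: "k \<in> {1..j} \<Longrightarrow> k \<in> {1..Suc j}" for k by simp
    have "R_diag t x x' p r * ?D x x' p r c d + R_swap t x x' p r * ?D x x' r p c d
        = R_diag t x x' c d * ?D x' x p r c d + R_swap t x x' d c * ?D x' x p r d c"
      by (rule Suc.IH[OF Suc.prems(1)[OF less] Suc.prems(2)[OF less]
            Suc.prems(3)[OF less less] le C(3) notin])
    then show ?thesis by simp
  qed simp
  have "R_diag t x x' a b * two_row n t x x' y T B (Suc j) a b c d
       + R_swap t x x' a b * two_row n t x x' y T B (Suc j) b a c d
     = (\<Sum>p\<le>n. \<Sum>r\<le>n. (R_diag t x x' a b * ?C x x' a b p r + R_swap t x x' a b * ?C x x' b a p r)
         * ?D x x' p r c d)"
    by (simp add: two_row_Suc sum_distrib_left sum.distrib algebra_simps)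
  also have "\<dots> = (\<Sum>p\<le>n. \<Sum>r\<le>n. (R_diag t x x' p r * ?C x' x a b p r + R_swap t x x' r p * ?C x' x a b r p)
         * ?D x x' p r c d)"
    by (simp only: column_pair_exchange[OF t top(2,1) Suc.prems(4,5) top(3,4) Suc.prems(6)])
  also have "\<dots> = (\<Sum>p\<le>n. \<Sum>r\<le>n. R_diag t x x' p r * ?C x' x a b p r * ?D x x' p r c d)
      + (\<Sum>p\<le>n. \<Sum>r\<le>n. R_swap t x x' r p * ?C x' x a b r p * ?D x x' p r c d)"
    by (simp add: distrib_right sum.distrib)
  \<comment> \<open>Renaming the inner spins puts the column first and the R-matrix to its right.\<close>
  also have "(\<Sum>p\<le>n. \<Sum>r\<le>n. R_swap t x x' r p * ?C x' x a b r p * ?D x x' p r c d)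
      = (\<Sum>p\<le>n. \<Sum>r\<le>n. R_swap t x x' p r * ?C x' x a b p r * ?D x x' r p c d)"
    by (rule sum.swap)
  also have "(\<Sum>p\<le>n. \<Sum>r\<le>n. R_diag t x x' p r * ?C x' x a b p r * ?D x x' p r c d) + \<dots>
     = (\<Sum>p\<le>n. \<Sum>r\<le>n. ?C x' x a b p r
          * (R_diag t x x' p r * ?D x x' p r c d + R_swap t x x' p r * ?D x x' r p c d))"
    by (simp add: sum.distrib algebra_simps)
  also have "\<dots> = (\<Sum>p\<le>n. \<Sum>r\<le>n. ?C x' x a b p r
          * (R_diag t x x' c d * ?D x' x p r c d + R_swap t x x' d c * ?D x' x p r d c))"
    by (simp only: IH)
  also have "\<dots> = R_diag t x x' c d * two_row n t x' x y T B (Suc j) a b c d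
       + R_swap t x x' d c * two_row n t x' x y T B (Suc j) a b d c"
    by (simp add: two_row_Suc sum_distrib_left sum.distrib algebra_simps)
  finally show ?case .
qed

section \<open>The partition function as a sum over rows\<close>

lemma sum_PiE_curry:
  "(\<Sum>h\<in>Pi\<^sub>E (A \<times> B) C. G h) =
   (\<Sum>g\<in>Pi\<^sub>E A (\<lambda>i. Pi\<^sub>E B (\<lambda>j. C (i, j))). G (restrict (\<lambda>(i, j). g i j) (A \<times> B)))"
  by (rule sum.reindex_bij_witness[where i = "\<lambda>g. restrict (\<lambda>(i, j). g i j) (A \<times> B)"
        and j = "\<lambda>h. \<lambda>i\<in>A. \<lambda>j\<in>B. h (i, j)"])
    (auto simp: PiE_iff extensional_def fun_eq_iff intro!: arg_cong[of _ _ G])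

abbreviation spins :: "nat \<Rightarrow> nat option set" where
  "spins n \<equiv> insert None (Some ` {1..n})"

lemma spins_eq: "spins n = spin ` {..n}"
  by (auto simp: spin_def image_iff gr0_conv_Suc) (metis Suc_le_D Suc_le_mono atMost_iff)

lemma inj_spin: "inj spin"
  by (auto simp: inj_def spin_def split: if_splits)

text \<open>
  The condition on the leftmost edge is kept inside the sum, since the induction moves that edge.
\<close>

lemma sum_paths_eq_row_weight:
  assumes "c \<le> n" "a \<le> n"
  shows "(\<Sum>g\<in>Pi\<^sub>E {0..j} (\<lambda>k. if k = 0 then {spin c} else spins n).
      (if g j = spin a then \<Prod>k\<in>{1..j}. vertex_weight t x (y k) (g k) (T k) (g (k - 1)) (B k) else 0))
    = row_weight n t x y T B j a c"
  using assms(2)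
proof (induction j arbitrary: a)
  case 0
  have "Pi\<^sub>E {0..0::nat} (\<lambda>k. if k = 0 then {spin c} else spins n) = {0} \<rightarrow>\<^sub>E {spin c}"
    unfolding atLeastAtMost_singleton by (rule PiE_cong) simp
  moreover have "spin c = spin a \<longleftrightarrow> a = c" using inj_spin by (auto simp: inj_eq)
  ultimately show ?case by simp
next
  case (Suc j)
  let ?D = "\<lambda>k::nat. if k = 0 then {spin c} else spins n"
  let ?p = "\<lambda>g j. \<Prod>k\<in>{1..j}. vertex_weight t x (y k) (g k) (T k) (g (k - 1)) (B k)"
  let ?v = "\<lambda>b d. vertex_weight t x (y (Suc j)) b (T (Suc j)) d (B (Suc j))"
  have ins: "{0..Suc j} = insert (Suc j) {0..j}" by auto
  have ins': "{1..Suc j} = insert (Suc j) {1..j}" by auto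
  have p: "?p (g(Suc j := b)) (Suc j) = ?v b (g j) * ?p g j" for g b
  proof -
    have "?p (g(Suc j := b)) j = ?p g j" by (intro prod.cong refl) auto
    moreover have "?p (g(Suc j := b)) (Suc j) = ?v b (g j) * ?p (g(Suc j := b)) j"
      unfolding ins' by (subst prod.insert) simp_all
    ultimately show ?thesis by (simp only:)
  qed
  have one_spin: "(\<Sum>m\<le>n. if g j = spin m then X m else 0) = X'"
    if g: "g \<in> Pi\<^sub>E {0..j} ?D" and X: "\<And>m. g j = spin m \<Longrightarrow> X m = X'" for g and X :: "nat \<Rightarrow> 'a" and X'
  proof -
    have "g j \<in> ?D j" using g by (rule PiE_mem) simp
    then have "g j \<in> spin ` {..n}"
      unfolding spins_eq using assms(1) by (cases "j = 0") simp_all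
    then obtain m where m: "m \<le> n" "g j = spin m" by auto
    then have "(\<Sum>m\<le>n. if g j = spin m then X m else 0) = (\<Sum>k\<le>n. if k = m then X' else 0)"
      using inj_spin X by (intro sum.cong) (auto simp: inj_eq)
    with m(1) show ?thesis by (simp only: sum.delta finite_atMost atMost_iff if_True)
  qed
  have notin: "Suc j \<notin> {0..j}" and D: "(if Suc j = 0 then {spin c} else spins n) = spins n" by simp_all
  have a: "spin a \<in> spins n" unfolding spins_eq using Suc.prems by simp
  have "(\<Sum>g\<in>Pi\<^sub>E {0..Suc j} ?D. if g (Suc j) = spin a then ?p g (Suc j) else 0)
     = (\<Sum>b\<in>spins n. \<Sum>g\<in>Pi\<^sub>E {0..j} ?D. if b = spin a then ?v b (g j) * ?p g j else 0)"
    unfolding ins sum_PiE_insert[OF notin] p fun_upd_same by (simp only: D)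
  also have "\<dots> = (\<Sum>g\<in>Pi\<^sub>E {0..j} ?D. \<Sum>b\<in>spins n. if b = spin a then ?v b (g j) * ?p g j else 0)"
    by (rule sum.swap)
  also have "\<dots> = (\<Sum>g\<in>Pi\<^sub>E {0..j} ?D. ?v (spin a) (g j) * ?p g j)"
    using a by (simp only: sum.delta finite_insert finite_imageI finite_atLeastAtMost if_True)
  also have "\<dots> = (\<Sum>g\<in>Pi\<^sub>E {0..j} ?D. \<Sum>m\<le>n. if g j = spin m then ?v (spin a) (spin m) * ?p g j else 0)"
    by (intro sum.cong refl one_spin[symmetric]) simp_all
  also have "\<dots> = (\<Sum>m\<le>n. \<Sum>g\<in>Pi\<^sub>E {0..j} ?D. if g j = spin m then ?v (spin a) (spin m) * ?p g j else 0)"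
    by (rule sum.swap)
  also have "\<dots> = (\<Sum>m\<le>n. ?v (spin a) (spin m) * (\<Sum>g\<in>Pi\<^sub>E {0..j} ?D. if g j = spin m then ?p g j else 0))"
    unfolding sum_distrib_left by (intro sum.cong refl) simp
  also have "\<dots> = row_weight n t x y T B (Suc j) a c"
    using Suc.IH by simp
  finally show ?case .
qed

text \<open>
  The values that the vertical edge of column \<open>j\<close> between the rows \<open>i\<close> and \<open>i + 1\<close> may take; for
  \<open>i = 0\<close> and \<open>i = n\<close> these are the boundary conditions.
\<close>

definition levels :: "nat \<Rightarrow> (nat \<Rightarrow> nat) \<Rightarrow> nat \<Rightarrow> nat \<Rightarrow> nat set set" where
  "levels n \<sigma> i j = (if i = 0 then {{\<sigma> j}} else if i = n then {{}} else Pow {1..n})"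

lemma sum_rows_eq_row_weight:
  assumes "0 < n" "c \<in> {1..n}"
  shows "(\<Sum>g\<in>Pi\<^sub>E {0..n} (\<lambda>j. if j = n then {None} else if j = 0 then {Some c} else spins n).
      \<Prod>j\<in>{1..n}. vertex_weight t x (y j) (g j) (T j) (g (j - 1)) (B j)) = row_weight n t x y T B n 0 c"
proof -
  let ?p = "\<lambda>g. \<Prod>j\<in>{1..n}. vertex_weight t x (y j) (g j) (T j) (g (j - 1)) (B j)"
  let ?E = "Pi\<^sub>E {0..n} (\<lambda>j. if j = 0 then {spin c} else spins n)"
  have "(\<Sum>g\<in>Pi\<^sub>E {0..n} (\<lambda>j. if j = n then {None} else if j = 0 then {Some c} else spins n). ?p g)
      = (\<Sum>g\<in>?E. if g n = spin 0 then ?p g else 0)"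
  proof (rule sum.mono_neutral_cong_left)
    show "finite ?E" by (rule finite_PiE) auto
    show "Pi\<^sub>E {0..n} (\<lambda>j. if j = n then {None} else if j = 0 then {Some c} else spins n) \<subseteq> ?E"
      using assms by (intro PiE_mono) (auto simp: spin_def)
    show "\<forall>g\<in>?E - Pi\<^sub>E {0..n} (\<lambda>j. if j = n then {None} else if j = 0 then {Some c} else spins n).
       (if g n = spin 0 then ?p g else 0) = 0"
    proof
      fix g assume g: "g \<in> ?E - Pi\<^sub>E {0..n} (\<lambda>j. if j = n then {None} else if j = 0 then {Some c} else spins n)"
      then obtain j where j: "j \<in> {0..n}" "g j \<notin> (if j = n then {None} else if j = 0 then {Some c} else spins n)"
        by (auto simp: PiE_iff)
      moreover have "g j \<in> (if j = 0 then {spin c} else spins n)" using g j(1) by blast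
      ultimately have "g n \<noteq> spin 0" using assms by (auto simp: spin_def split: if_splits)
      then show "(if g n = spin 0 then ?p g else 0) = 0" by simp
    qed
    show "?p g = (if g n = spin 0 then ?p g else 0)"
      if "g \<in> Pi\<^sub>E {0..n} (\<lambda>j. if j = n then {None} else if j = 0 then {Some c} else spins n)" for g
    proof -
      have "g n \<in> {None}" using PiE_mem[OF that, of n] by simp
      then show ?thesis by (simp add: spin_def)
    qed
  qed
  also have "\<dots> = row_weight n t x y T B n 0 c"
    using assms by (intro sum_paths_eq_row_weight) auto
  finally show ?thesis .
qed

text \<open>
  Absorbing the boundary conditions into dependent function spaces makes products of sums available.
\<close>

lemma lattice_states_eq_PiE:
  assumes "\<And>i. i \<in> {1..n} \<Longrightarrow> w i \<in> {1..n}" "\<And>j. j \<in> {1..n} \<Longrightarrow> \<sigma> j \<in> {1..n}"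
  shows "lattice_states n \<sigma> w =
    Pi\<^sub>E ({1..n} \<times> {0..n}) (\<lambda>(i, j). if j = n then {None} else if j = 0 then {Some (w i)} else spins n)
    \<times> Pi\<^sub>E ({0..n} \<times> {1..n}) (\<lambda>(i, j). levels n \<sigma> i j)"
proof -
  let ?C = "\<lambda>i j. if j = n then {None} else if j = 0 then {Some (w i)} else spins n"
  have H: "h \<in> {1..n} \<times> {0..n} \<rightarrow>\<^sub>E spins n \<and> (\<forall>i\<in>{1..n}. h (i, n) = None \<and> h (i, 0) = Some (w i))
    \<longleftrightarrow> h \<in> Pi\<^sub>E ({1..n} \<times> {0..n}) (\<lambda>(i, j). ?C i j)" (is "?P \<and> ?Q \<longleftrightarrow> ?R") for h
  proof
    assume PQ: "?P \<and> ?Q"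
    have "h x \<in> (case x of (i, j) \<Rightarrow> ?C i j)" if "x \<in> {1..n} \<times> {0..n}" for x
    proof -
      obtain i j where x: "x = (i, j)" by (cases x)
      then have i: "i \<in> {1..n}" using that by simp
      have "h (i, j) \<in> spins n" using PQ that unfolding x by (meson PiE_mem)
      moreover have "h (i, n) = None" "h (i, 0) = Some (w i)" using PQ i by simp_all
      ultimately show ?thesis unfolding x by simp
    qed
    moreover have "h x = undefined" if "x \<notin> {1..n} \<times> {0..n}" for x
      using that PQ by (meson PiE_arb)
    ultimately show ?R by (rule PiE_I)
  next
    assume R: ?R
    have h: "h (i, j) \<in> ?C i j" if "i \<in> {1..n}" "j \<in> {0..n}" for i j
      using PiE_mem[OF R, of "(i, j)"] that by simp
    have ?P
    proof (rule PiE_I)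
      fix x assume "x \<in> {1..n} \<times> {0..n}"
      then obtain i j where "x = (i, j)" "i \<in> {1..n}" "j \<in> {0..n}" by auto
      then show "h x \<in> spins n" using h[of i j] assms(1)[of i] by (cases "j = n"; cases "j = 0") simp_all
    next
      fix x assume "x \<notin> {1..n} \<times> {0..n}"
      with R show "h x = undefined" by (rule PiE_arb)
    qed
    moreover have ?Q
    proof
      fix i assume i: "i \<in> {1..n}"
      then have "n \<noteq> 0" by auto
      then show "h (i, n) = None \<and> h (i, 0) = Some (w i)" using h[OF i, of n] h[OF i, of 0] by simp
    qed
    ultimately show "?P \<and> ?Q" ..
  qed
  have V: "v \<in> {0..n} \<times> {1..n} \<rightarrow>\<^sub>E Pow {1..n} \<and> (\<forall>j\<in>{1..n}. v (0, j) = {\<sigma> j} \<and> v (n, j) = {})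
    \<longleftrightarrow> v \<in> Pi\<^sub>E ({0..n} \<times> {1..n}) (\<lambda>(i, j). levels n \<sigma> i j)" (is "?P \<and> ?Q \<longleftrightarrow> ?R") for v
  proof
    assume PQ: "?P \<and> ?Q"
    have "v x \<in> (case x of (i, j) \<Rightarrow> levels n \<sigma> i j)" if "x \<in> {0..n} \<times> {1..n}" for x
    proof -
      obtain i j where x: "x = (i, j)" by (cases x)
      then have j: "j \<in> {1..n}" using that by simp
      have "v (i, j) \<in> Pow {1..n}" using PQ that unfolding x by (meson PiE_mem)
      moreover have "v (n, j) = {}" "v (0, j) = {\<sigma> j}" using PQ j by simp_all
      ultimately show ?thesis unfolding x by (simp add: levels_def)
    qed
    moreover have "v x = undefined" if "x \<notin> {0..n} \<times> {1..n}" for x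
      using that PQ by (meson PiE_arb)
    ultimately show ?R by (rule PiE_I)
  next
    assume R: ?R
    have v: "v (i, j) \<in> levels n \<sigma> i j" if "i \<in> {0..n}" "j \<in> {1..n}" for i j
      using PiE_mem[OF R, of "(i, j)"] that by simp
    have ?P
    proof (rule PiE_I)
      fix x assume "x \<in> {0..n} \<times> {1..n}"
      then obtain i j where "x = (i, j)" "i \<in> {0..n}" "j \<in> {1..n}" by auto
      then show "v x \<in> Pow {1..n}" using v[of i j] assms(2)[of j] by (cases "i = n"; cases "i = 0") (simp_all add: levels_def)
    next
      fix x assume "x \<notin> {0..n} \<times> {1..n}"
      with R show "v x = undefined" by (rule PiE_arb)
    qed
    moreover have ?Q
    proof
      fix j assume j: "j \<in> {1..n}"
      then have "n \<noteq> 0" by auto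
      then show "v (0, j) = {\<sigma> j} \<and> v (n, j) = {}" using v[OF _ j, of n] v[OF _ j, of 0] by (simp add: levels_def)
    qed
    ultimately show "?P \<and> ?Q" ..
  qed
  show ?thesis
    unfolding lattice_states_def set_eq_iff split_paired_All mem_Collect_eq case_prod_conv mem_Times_iff fst_conv snd_conv
      H[symmetric] V[symmetric] by (simp only: conj_ac simp_thms)
qed

text \<open>
  For fixed vertical spins the horizontal spins of different rows are independent, so the sum over them
  is a product of one-row partition functions.
\<close>

lemma partition_fun_rows:
  fixes t :: "'a::field"
  assumes "\<And>i. i \<in> {1..n} \<Longrightarrow> w i \<in> {1..n}" "\<And>j. j \<in> {1..n} \<Longrightarrow> \<sigma> j \<in> {1..n}"
  shows "partition_fun n t \<sigma> w x y =
    (\<Sum>V\<in>Pi\<^sub>E {0..n} (\<lambda>i. Pi\<^sub>E {1..n} (levels n \<sigma> i)).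
       \<Prod>i\<in>{1..n}. row_weight n t (x i) y (V (i - 1)) (V i) n 0 (w i))"
proof -
  let ?C = "\<lambda>i j. if j = n then {None} else if j = 0 then {Some (w i)} else spins n"
  let ?H = "Pi\<^sub>E ({1..n} \<times> {0..n}) (\<lambda>(i, j). ?C i j)"
  let ?V = "Pi\<^sub>E ({0..n} \<times> {1..n}) (\<lambda>(i, j). levels n \<sigma> i j)"
  let ?f = "\<lambda>h v. \<Prod>(i, j)\<in>{1..n} \<times> {1..n}.
      vertex_weight t (x i) (y j) (h (i, j)) (v (i - 1, j)) (h (i, j - 1)) (v (i, j))"
  have rows: "(\<Sum>h\<in>?H. ?f h (restrict (\<lambda>(i, j). V i j) ({0..n} \<times> {1..n})))
     = (\<Prod>i\<in>{1..n}. row_weight n t (x i) y (V (i - 1)) (V i) n 0 (w i))" for V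
  proof -
    have "(\<Sum>h\<in>?H. ?f h (restrict (\<lambda>(i, j). V i j) ({0..n} \<times> {1..n}))) =
      (\<Sum>g\<in>Pi\<^sub>E {1..n} (\<lambda>i. Pi\<^sub>E {0..n} (?C i)).
        ?f (restrict (\<lambda>(i, j). g i j) ({1..n} \<times> {0..n})) (restrict (\<lambda>(i, j). V i j) ({0..n} \<times> {1..n})))"
      by (subst sum_PiE_curry) simp
    also have "\<dots> = (\<Sum>g\<in>Pi\<^sub>E {1..n} (\<lambda>i. Pi\<^sub>E {0..n} (?C i)). \<Prod>i\<in>{1..n}. \<Prod>j\<in>{1..n}.
        vertex_weight t (x i) (y j) (g i j) (V (i - 1) j) (g i (j - 1)) (V i j))"
      unfolding prod.cartesian_product by (intro sum.cong prod.cong) auto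
    also have "\<dots> = (\<Prod>i\<in>{1..n}. \<Sum>g\<in>Pi\<^sub>E {0..n} (?C i). \<Prod>j\<in>{1..n}.
        vertex_weight t (x i) (y j) (g j) (V (i - 1) j) (g (j - 1)) (V i j))"
      by (subst prod_sum_PiE) (auto intro!: finite_PiE)
    also have "\<dots> = (\<Prod>i\<in>{1..n}. row_weight n t (x i) y (V (i - 1)) (V i) n 0 (w i))"
      using assms(1) by (intro prod.cong refl sum_rows_eq_row_weight) auto
    finally show ?thesis .
  qed
  have "partition_fun n t \<sigma> w x y = (\<Sum>(h, v)\<in>?H \<times> ?V. ?f h v)"
    by (simp only: partition_fun_def lattice_states_eq_PiE[of n w \<sigma>, OF assms])
  also have "\<dots> = (\<Sum>v\<in>?V. \<Sum>h\<in>?H. ?f h v)"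
    unfolding sum.cartesian_product[symmetric] by (rule sum.swap)
  also have "\<dots> = (\<Sum>V\<in>Pi\<^sub>E {0..n} (\<lambda>i. Pi\<^sub>E {1..n} (levels n \<sigma> i)).
      \<Sum>h\<in>?H. ?f h (restrict (\<lambda>(i, j). V i j) ({0..n} \<times> {1..n})))"
    by (subst sum_PiE_curry) simp
  also have "\<dots> = (\<Sum>V\<in>Pi\<^sub>E {0..n} (\<lambda>i. Pi\<^sub>E {1..n} (levels n \<sigma> i)).
       \<Prod>i\<in>{1..n}. row_weight n t (x i) y (V (i - 1)) (V i) n 0 (w i))"
    by (simp only: rows)
  finally show ?thesis .
qed

text \<open>
  Only rows \<open>i\<close> and \<open>i + 1\<close> see the vertical spins between them.
\<close>

lemma partition_fun_two_rows:
  fixes t :: "'a::field"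
  assumes "\<And>i. i \<in> {1..n} \<Longrightarrow> w i \<in> {1..n}" "\<And>j. j \<in> {1..n} \<Longrightarrow> \<sigma> j \<in> {1..n}"
    and i: "i \<in> {1..<n}"
  shows "partition_fun n t \<sigma> w x y =
    (\<Sum>V\<in>Pi\<^sub>E ({0..n} - {i}) (\<lambda>i. Pi\<^sub>E {1..n} (levels n \<sigma> i)).
       (\<Prod>k\<in>{1..n} - {i, Suc i}. row_weight n t (x k) y (V (k - 1)) (V k) n 0 (w k))
       * two_row n t (x i) (x (Suc i)) y (V (i - 1)) (V (Suc i)) n 0 0 (w i) (w (Suc i)))"
proof -
  let ?L = "\<lambda>i. Pi\<^sub>E {1..n} (levels n \<sigma> i)"
  let ?r = "\<lambda>V k. row_weight n t (x k) y (V (k - 1)) (V k) n 0 (w k)"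
  let ?P = "\<lambda>V. \<Prod>k\<in>{1..n} - {i, Suc i}. ?r V k"
  have ins: "{0..n} = insert i ({0..n} - {i})" using i by auto
  have lev: "?L i = {1..n} \<rightarrow>\<^sub>E Pow {1..n}" using i by (intro PiE_cong) (auto simp: levels_def)
  \<comment> \<open>The level below row \<open>i\<close> occurs in the weights of rows \<open>i\<close> and \<open>i + 1\<close> only.\<close>
  have split: "(\<Prod>k\<in>{1..n}. ?r (V(i := m)) k) = ?P V *
     (row_weight n t (x i) y (V (i - 1)) m n 0 (w i)
      * row_weight n t (x (Suc i)) y m (V (Suc i)) n 0 (w (Suc i)))" for V m
  proof -
    have "(\<Prod>k\<in>{1..n}. ?r (V(i := m)) k) =
      ?P (V(i := m)) * (\<Prod>k\<in>{i, Suc i}. ?r (V(i := m)) k)"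
      using i by (intro prod.subset_diff) auto
    moreover have "?P (V(i := m)) = ?P V"
      using i by (intro prod.cong) auto
    moreover have "(\<Prod>k\<in>{i, Suc i}. ?r (V(i := m)) k) =
      row_weight n t (x i) y (V (i - 1)) m n 0 (w i)
      * row_weight n t (x (Suc i)) y m (V (Suc i)) n 0 (w (Suc i))"
      using i by auto
    ultimately show ?thesis by simp
  qed
  have "partition_fun n t \<sigma> w x y =
    (\<Sum>m\<in>?L i. \<Sum>V\<in>Pi\<^sub>E ({0..n} - {i}) ?L. \<Prod>k\<in>{1..n}. ?r (V(i := m)) k)"
    by (simp only: partition_fun_rows[of n w \<sigma>, OF assms(1,2)], subst ins, rule sum_PiE_insert) simp
  also have "\<dots> = (\<Sum>V\<in>Pi\<^sub>E ({0..n} - {i}) ?L. ?P V *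
      two_row n t (x i) (x (Suc i)) y (V (i - 1)) (V (Suc i)) n 0 0 (w i) (w (Suc i)))"
    unfolding split lev two_row_def sum_distrib_left by (rule sum.swap)
  finally show ?thesis .
qed

section \<open>The exchange relation for partition functions\<close>

lemma row_weight_Suc_nonzeroE:
  fixes t :: "'a::field"
  assumes "t \<noteq> 0" "T (Suc j) \<subseteq> {1..n}" "a \<notin> T (Suc j)" "row_weight n t x y T B (Suc j) a c \<noteq> 0"
  obtains m where "m \<le> n" "m = a \<or> m = 0 \<or> m \<in> T (Suc j)" "B (Suc j) = move (T (Suc j)) a m"
    "row_weight n t x y T B j m c \<noteq> 0"
proof -
  have fin: "finite (T (Suc j))" and zero: "0 \<notin> T (Suc j)"
    using assms(2) by (auto intro: finite_subset)
  from assms(4) obtain m where m: "m \<le> n"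
    "vertex_weight t x (y (Suc j)) (spin a) (T (Suc j)) (spin m) (B (Suc j)) * row_weight n t x y T B j m c \<noteq> 0"
    by (auto elim: sum.not_neutral_contains_not_neutral)
  then show thesis
    using that by (auto simp: vertex_weight_spin[OF assms(1) fin zero assms(3)] split: if_splits)
qed

lemma spin_not_in_remaining:
  fixes T :: "nat \<Rightarrow> nat set"
  assumes "\<And>k. k \<in> {1..Suc j} \<Longrightarrow> T k \<subseteq> {1..n}" "disjoint_family_on T {1..Suc j}"
    and "\<And>k. k \<in> {1..Suc j} \<Longrightarrow> a \<notin> T k" "m = a \<or> m = 0 \<or> m \<in> T (Suc j)" "k \<in> {1..j}"
  shows "m \<notin> T k"
proof -
  have k: "k \<in> {1..Suc j}" "Suc j \<in> {1..Suc j}" "k \<noteq> Suc j" using assms(5) by auto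
  have "T k \<inter> T (Suc j) = {}" using disjoint_family_onD[OF assms(2) k] .
  moreover have "0 \<notin> T k" "a \<notin> T k" using assms(1)[OF k(1)] assms(3)[OF k(1)] by auto
  ultimately show ?thesis using assms(4) by auto
qed

text \<open>
  Colors are conserved along a row: the one that travels horizontally is in no column, and it leaves a
  column only in exchange for another color or for none.
\<close>

lemma row_weight_preserves_disjointness:
  fixes t :: "'a::field"
  assumes "t \<noteq> 0" "\<And>k. k \<in> {1..j} \<Longrightarrow> T k \<subseteq> {1..n}" "disjoint_family_on T {1..j}"
    and "\<And>k. k \<in> {1..j} \<Longrightarrow> a \<notin> T k" "row_weight n t x y T B j a c \<noteq> 0"
  shows "disjoint_family_on B {1..j} \<and> (\<forall>k\<in>{1..j}. B k \<subseteq> insert a (\<Union>l\<in>{1..j}. T l) - {0})"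
  using assms(2-)
proof (induction j arbitrary: a)
  case 0
  show ?case by (simp add: disjoint_family_on_def)
next
  case (Suc j)
  have top: "T (Suc j) \<subseteq> {1..n}" "a \<notin> T (Suc j)" using Suc.prems(1,3)[of "Suc j"] by simp_all
  obtain m where m: "m \<le> n" "m = a \<or> m = 0 \<or> m \<in> T (Suc j)" "B (Suc j) = move (T (Suc j)) a m"
    "row_weight n t x y T B j m c \<noteq> 0"
    using row_weight_Suc_nonzeroE[OF assms(1) top Suc.prems(4)] by metis
  have sub: "k \<in> {1..j} \<Longrightarrow> k \<in> {1..Suc j}" for k by simp
  have disj: "disjoint_family_on T {1..j}"
    using Suc.prems(2) by (rule disjoint_family_on_mono[rotated]) auto
  have IH: "disjoint_family_on B {1..j}" "\<And>k. k \<in> {1..j} \<Longrightarrow> B k \<subseteq> insert m (\<Union>l\<in>{1..j}. T l) - {0}"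
    using Suc.IH[OF Suc.prems(1)[OF sub] disj spin_not_in_remaining[OF Suc.prems(1-3) m(2)] m(4)]
    by simp_all
  have last: "B (Suc j) \<inter> B k = {}" if k: "k \<in> {1..j}" for k
  proof -
    have "e \<notin> B (Suc j)" if e: "e \<in> B k" for e
    proof -
      have "e \<noteq> 0" using IH(2)[OF k] e by auto
      from IH(2)[OF k] e have "e = m \<or> (\<exists>l\<in>{1..j}. e \<in> T l)" by auto
      then consider "e = m" | l where "l \<in> {1..j}" "e \<in> T l" by blast
      then show ?thesis
      proof cases
        case 1
        then show ?thesis by (simp add: m(3) move_def)
      next
        case 2
        then have "e \<noteq> a" using Suc.prems(3) sub by metis
        moreover have "T l \<inter> T (Suc j) = {}"
          using Suc.prems(2) 2(1) by (intro disjoint_family_onD) auto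
        ultimately show ?thesis using 2(2) by (auto simp: m(3) move_def)
      qed
    qed
    then show ?thesis by auto
  qed
  have "disjoint_family_on B (insert (Suc j) {1..j})"
    unfolding disjoint_family_on_def
  proof (intro ballI impI)
    fix k l assume kl: "k \<in> insert (Suc j) {1..j}" "l \<in> insert (Suc j) {1..j}" "k \<noteq> l"
    show "B k \<inter> B l = {}"
    proof (cases "k = Suc j")
      case True
      then show ?thesis using kl last[of l] by simp
    next
      case k: False
      then have k: "k \<in> {1..j}" using kl by simp
      show ?thesis
      proof (cases "l = Suc j")
        case True
        then show ?thesis using last[OF k] by (simp add: Int_commute)
      next
        case False
        then have "l \<in> {1..j}" using kl by simp
        then show ?thesis by (rule disjoint_family_onD[OF IH(1) k _ kl(3)])
      qed
    qed
  qed
  moreover have "insert (Suc j) {1..j} = {1..Suc j}" by auto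
  moreover have "B k \<subseteq> insert a (\<Union>l\<in>{1..Suc j}. T l) - {0}" if k: "k \<in> {1..Suc j}" for k
  proof (cases "k = Suc j")
    case True
    then show ?thesis by (auto simp: m(3) move_def)
  next
    case False
    then have "B k \<subseteq> insert m (\<Union>l\<in>{1..j}. T l) - {0}" using IH(2) k by simp
    moreover have "(\<Union>l\<in>{1..j}. T l) \<subseteq> (\<Union>l\<in>{1..Suc j}. T l)" by (rule UN_mono) auto
    moreover have "m \<in> insert 0 (insert a (\<Union>l\<in>{1..Suc j}. T l))"
      using m(2) by (elim disjE) auto
    ultimately show ?thesis by blast
  qed
  ultimately show ?case by simp
qed

text \<open>
  This is where it matters that the top boundary carries each color once.
\<close>

lemma levels_disjoint:
  fixes t :: "'a::field" and V :: "nat \<Rightarrow> nat \<Rightarrow> nat set"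
  assumes "t \<noteq> 0" "inj_on \<sigma> {1..n}" "\<And>j. j \<in> {1..n} \<Longrightarrow> V 0 j = {\<sigma> j}"
    and "\<And>i j. i \<le> m \<Longrightarrow> j \<in> {1..n} \<Longrightarrow> V i j \<subseteq> {1..n}"
    and "\<And>k. k \<in> {1..m} \<Longrightarrow> row_weight n t (x k) y (V (k - 1)) (V k) n 0 (w k) \<noteq> 0"
  shows "disjoint_family_on (V m) {1..n}"
  using assms(4,5)
proof (induction m)
  case 0
  show ?case unfolding disjoint_family_on_def
  proof (intro ballI impI)
    fix i j assume ij: "i \<in> {1..n}" "j \<in> {1..n}" "i \<noteq> j"
    then have "\<sigma> i \<noteq> \<sigma> j" using inj_onD[OF assms(2)] by metis
    then show "V 0 i \<inter> V 0 j = {}" unfolding assms(3)[OF ij(1)] assms(3)[OF ij(2)] by simp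
  qed
next
  case (Suc m)
  have disj: "disjoint_family_on (V m) {1..n}"
    using Suc.prems by (intro Suc.IH) simp_all
  have sub: "V m k \<subseteq> {1..n}" if "k \<in> {1..n}" for k using Suc.prems(1)[of m k] that by simp
  then have zero: "0 \<notin> V m k" if "k \<in> {1..n}" for k using that by fastforce
  have "row_weight n t (x (Suc m)) y (V m) (V (Suc m)) n 0 (w (Suc m)) \<noteq> 0"
    using Suc.prems(2)[of "Suc m"] by simp
  from row_weight_preserves_disjointness[OF assms(1) sub disj zero this]
  show ?case by simp
qed

text \<open>
  The R-matrix is inserted between the uncolored left boundary edges of rows \<open>i\<close> and \<open>i + 1\<close>, where it
  acts by the scalar on the left side, and is moved through to the right boundary, where for
  \<open>w (i + 1) < w i\<close> it contributes the two coefficients on the right side.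
\<close>

lemma partition_fun_exchange:
  fixes t :: "'a::field"
  assumes t: "t \<noteq> 0" and y: "\<And>j. j \<in> {1..n} \<Longrightarrow> y j \<noteq> 0"
    and \<sigma>: "\<sigma> permutes {1..n}" and w: "w permutes {1..n}"
    and i: "i \<in> {1..<n}" and desc: "w (Suc i) < w i"
  shows "(x i - t * x (Suc i)) * partition_fun n t \<sigma> w (x \<circ> simple_refl i) y
     = (x (Suc i) - x i) * partition_fun n t \<sigma> (w \<circ> simple_refl i) x y
       + (1 - t) * x (Suc i) * partition_fun n t \<sigma> w x y"
proof -
  let ?V = "Pi\<^sub>E ({0..n} - {i}) (\<lambda>i. Pi\<^sub>E {1..n} (levels n \<sigma> i))"
  let ?P = "\<lambda>V. \<Prod>k\<in>{1..n} - {i, Suc i}. row_weight n t (x k) y (V (k - 1)) (V k) n 0 (w k)"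
  let ?D = "\<lambda>x x' V c d. two_row n t x x' y (V (i - 1)) (V (Suc i)) n 0 0 c d"
  have s: "simple_refl i i = Suc i" "simple_refl i (Suc i) = i"
    "\<And>k. k \<noteq> i \<Longrightarrow> k \<noteq> Suc i \<Longrightarrow> simple_refl i k = k"
    by (simp_all add: simple_refl_def)
  have w_in: "w k \<in> {1..n}" if "k \<in> {1..n}" for k using permutes_in_image[OF w] that by simp
  have \<sigma>_in: "\<sigma> k \<in> {1..n}" if "k \<in> {1..n}" for k using permutes_in_image[OF \<sigma>] that by simp
  have ws_in: "(w \<circ> simple_refl i) k \<in> {1..n}" if "k \<in> {1..n}" for k
    using that i w_in s by (cases "k = i"; cases "k = Suc i") simp_all
  have Z1: "partition_fun n t \<sigma> w x y = (\<Sum>V\<in>?V. ?P V * ?D (x i) (x (Suc i)) V (w i) (w (Suc i)))"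
    by (rule partition_fun_two_rows[of n w \<sigma>, OF w_in \<sigma>_in i])
  have "partition_fun n t \<sigma> w (x \<circ> simple_refl i) y =
     (\<Sum>V\<in>?V. (\<Prod>k\<in>{1..n} - {i, Suc i}. row_weight n t ((x \<circ> simple_refl i) k) y (V (k - 1)) (V k) n 0 (w k))
       * ?D ((x \<circ> simple_refl i) i) ((x \<circ> simple_refl i) (Suc i)) V (w i) (w (Suc i)))"
    by (rule partition_fun_two_rows[of n w \<sigma>, OF w_in \<sigma>_in i])
  also have "\<dots> = (\<Sum>V\<in>?V. ?P V * ?D (x (Suc i)) (x i) V (w i) (w (Suc i)))"
    by (intro sum.cong arg_cong2[where f = "(*)"] prod.cong) (auto simp: s)
  finally have Z2: "partition_fun n t \<sigma> w (x \<circ> simple_refl i) y = \<dots>" .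
  have "partition_fun n t \<sigma> (w \<circ> simple_refl i) x y =
     (\<Sum>V\<in>?V. (\<Prod>k\<in>{1..n} - {i, Suc i}. row_weight n t (x k) y (V (k - 1)) (V k) n 0 ((w \<circ> simple_refl i) k))
       * ?D (x i) (x (Suc i)) V ((w \<circ> simple_refl i) i) ((w \<circ> simple_refl i) (Suc i)))"
    by (rule partition_fun_two_rows[of n "w \<circ> simple_refl i" \<sigma>, OF ws_in \<sigma>_in i])
  also have "\<dots> = (\<Sum>V\<in>?V. ?P V * ?D (x i) (x (Suc i)) V (w (Suc i)) (w i))"
    by (intro sum.cong arg_cong2[where f = "(*)"] prod.cong) (auto simp: s)
  finally have Z3: "partition_fun n t \<sigma> (w \<circ> simple_refl i) x y = \<dots>" .
  have pos: "0 < w (Suc i)" using w_in[of "Suc i"] i by simp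
  \<comment> \<open>If the other rows have nonzero weight, colors stay disjoint down to row \<open>i\<close>, which the two-row relation requires.\<close>
  have local_exchange: "?P V * ((x i - t * x (Suc i)) * ?D (x (Suc i)) (x i) V (w i) (w (Suc i)))
    = ?P V * ((x (Suc i) - x i) * ?D (x i) (x (Suc i)) V (w (Suc i)) (w i)
        + (1 - t) * x (Suc i) * ?D (x i) (x (Suc i)) V (w i) (w (Suc i)))" if V: "V \<in> ?V" for V
  proof (cases "?P V = 0")
    case False
    have lev: "V k j \<in> levels n \<sigma> k j" if "k \<in> {0..n} - {i}" "j \<in> {1..n}" for k j
      using PiE_mem[OF PiE_mem[OF V that(1)] that(2)] .
    have sub: "V k j \<subseteq> {1..n}" if "k \<le> i - 1" "j \<in> {1..n}" for k j
    proof -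
      have "k \<in> {0..n} - {i}" using that i by auto
      from lev[OF this that(2)] \<sigma>_in[OF that(2)] show ?thesis
        by (auto simp: levels_def split: if_splits)
    qed
    have disj: "disjoint_family_on (V (i - 1)) {1..n}"
    proof (rule levels_disjoint[OF t, of \<sigma> n V "i - 1" x y w])
      show "inj_on \<sigma> {1..n}" using permutes_inj_on[OF \<sigma>] .
      show "V 0 j = {\<sigma> j}" if "j \<in> {1..n}" for j
        using lev[of 0 j] that i by (auto simp: levels_def)
      show "row_weight n t (x k) y (V (k - 1)) (V k) n 0 (w k) \<noteq> 0" if "k \<in> {1..i - 1}" for k
      proof -
        have "k \<in> {1..n} - {i, Suc i}" using that i by auto
        with False show ?thesis by auto
      qed
    qed (use sub in auto)
    have zero: "0 \<notin> V (i - 1) k \<and> 0 \<notin> V (i - 1) k" if "k \<in> {1..n}" for k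
      using sub[of "i - 1" k] that by auto
    have "R_diag t (x (Suc i)) (x i) 0 0 * ?D (x (Suc i)) (x i) V (w i) (w (Suc i))
        + R_swap t (x (Suc i)) (x i) 0 0 * ?D (x (Suc i)) (x i) V (w i) (w (Suc i))
      = R_diag t (x (Suc i)) (x i) (w i) (w (Suc i)) * ?D (x i) (x (Suc i)) V (w i) (w (Suc i))
        + R_swap t (x (Suc i)) (x i) (w (Suc i)) (w i) * ?D (x i) (x (Suc i)) V (w (Suc i)) (w i)"
      by (rule two_row_exchange[OF t y sub[of "i - 1"] disjoint_family_onD[OF disj] _ _ _ zero]) simp_all
    then show ?thesis using desc pos by (simp add: R_diag_def R_swap_def add.commute)
  qed simp
  have "(x i - t * x (Suc i)) * partition_fun n t \<sigma> w (x \<circ> simple_refl i) y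
    = (\<Sum>V\<in>?V. ?P V * ((x i - t * x (Suc i)) * ?D (x (Suc i)) (x i) V (w i) (w (Suc i))))"
    unfolding Z2 by (simp add: sum_distrib_left mult_ac)
  also have "\<dots> = (\<Sum>V\<in>?V. ?P V * ((x (Suc i) - x i) * ?D (x i) (x (Suc i)) V (w (Suc i)) (w i)
        + (1 - t) * x (Suc i) * ?D (x i) (x (Suc i)) V (w i) (w (Suc i))))"
    by (intro sum.cong refl local_exchange)
  also have "\<dots> = (x (Suc i) - x i) * partition_fun n t \<sigma> (w \<circ> simple_refl i) x y
       + (1 - t) * x (Suc i) * partition_fun n t \<sigma> w x y"
    unfolding Z1 Z3 sum_distrib_left sum.distrib[symmetric]
    by (intro sum.cong refl) (simp add: algebra_simps)
  finally show ?thesis .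
qed

section \<open>The frozen boundary condition\<close>

text \<open>
  A color that is neither present on the left nor in a column cannot leave on the right.
\<close>

lemma row_weight_stray_exit:
  fixes t :: "'a::field"
  assumes "t \<noteq> 0" "\<And>k. k \<in> {1..j} \<Longrightarrow> T k \<subseteq> {1..n}" "disjoint_family_on T {1..j}"
    and "\<And>k. k \<in> {1..j} \<Longrightarrow> a \<notin> T k" "\<And>k. k \<in> {1..j} \<Longrightarrow> c \<notin> T k" "0 < c" "a \<noteq> c"
  shows "row_weight n t x y T B j a c = 0"
  using assms(2-5,7)
proof (induction j arbitrary: a)
  case (Suc j)
  show ?case
  proof (rule ccontr)
    assume nz: "row_weight n t x y T B (Suc j) a c \<noteq> 0"
    have top: "T (Suc j) \<subseteq> {1..n}" "a \<notin> T (Suc j)" "c \<notin> T (Suc j)"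
      using Suc.prems(1,3,4)[of "Suc j"] by simp_all
    obtain m where m: "m \<le> n" "m = a \<or> m = 0 \<or> m \<in> T (Suc j)" "row_weight n t x y T B j m c \<noteq> 0"
      using row_weight_Suc_nonzeroE[OF assms(1) top(1,2) nz] by metis
    have sub: "k \<in> {1..j} \<Longrightarrow> k \<in> {1..Suc j}" for k by simp
    have disj: "disjoint_family_on T {1..j}"
      using Suc.prems(2) by (rule disjoint_family_on_mono[rotated]) auto
    have ne: "m \<noteq> c" using m(2) top(3) Suc.prems(5) assms(6) by auto
    have "row_weight n t x y T B j m c = 0"
      by (rule Suc.IH[OF Suc.prems(1)[OF sub] disj spin_not_in_remaining[OF Suc.prems(1-3) m(2)]
            Suc.prems(4)[OF sub] ne])
    with m(3) show False by contradiction
  qed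
qed simp

text \<open>
  Once a color that sits in no column differs from the horizontal spin, it is lost; so it has to stay
  horizontal all along, and the columns are unchanged.
\<close>

lemma row_weight_through:
  fixes t :: "'a::field"
  assumes "t \<noteq> 0" "\<And>k. k \<in> {1..j} \<Longrightarrow> T k \<subseteq> {1..n}" "disjoint_family_on T {1..j}"
    and "\<And>k. k \<in> {1..j} \<Longrightarrow> c \<notin> T k" "0 < c" "c \<le> n"
  shows "row_weight n t x y T B j c c =
    (if \<forall>k\<in>{1..j}. B k = T k then \<Prod>k\<in>{1..j}. t ^ card {e \<in> T k. c < e} * (1 - x / y k) else 0)"
  using assms(2-4)
proof (induction j)
  case (Suc j)
  have top: "T (Suc j) \<subseteq> {1..n}" "c \<notin> T (Suc j)" using Suc.prems(1,3)[of "Suc j"] by simp_all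
  have sub: "k \<in> {1..j} \<Longrightarrow> k \<in> {1..Suc j}" for k by simp
  have disj: "disjoint_family_on T {1..j}"
    using Suc.prems(2) by (rule disjoint_family_on_mono[rotated]) auto
  let ?v = "\<lambda>m. vertex_weight t x (y (Suc j)) (spin c) (T (Suc j)) (spin m) (B (Suc j))"
  let ?f = "\<lambda>k. t ^ card {e \<in> T k. c < e} * (1 - x / y k)"
  have fin: "finite (T (Suc j))" and zero: "0 \<notin> T (Suc j)"
    using top(1) by (auto intro: finite_subset)
  have stray: "?v m * row_weight n t x y T B j m c = 0" if "m \<noteq> c" for m
  proof (cases "m = 0 \<or> m \<in> T (Suc j)")
    case True
    then have m: "m = c \<or> m = 0 \<or> m \<in> T (Suc j)" by simp
    have "row_weight n t x y T B j m c = 0"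
      by (rule row_weight_stray_exit[OF assms(1) Suc.prems(1)[OF sub] disj
            spin_not_in_remaining[OF Suc.prems m] Suc.prems(3)[OF sub] assms(5) that])
    then show ?thesis by simp
  next
    case False
    then show ?thesis using that by (simp add: vertex_weight_spin[OF assms(1) fin zero top(2)])
  qed
  have v: "?v c = (if B (Suc j) = T (Suc j) then ?f (Suc j) else 0)"
    using top(2) assms(5) by (simp add: vertex_weight_def spin_def)
  have all: "(\<forall>k\<in>{1..Suc j}. B k = T k) \<longleftrightarrow> B (Suc j) = T (Suc j) \<and> (\<forall>k\<in>{1..j}. B k = T k)"
  proof -
    have "{1..Suc j} = insert (Suc j) {1..j}" by auto
    then show ?thesis by simp
  qed
  have "row_weight n t x y T B (Suc j) c c = (\<Sum>m\<le>n. if m = c then ?v c * row_weight n t x y T B j c c else 0)"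
    unfolding row_weight.simps by (intro sum.cong refl) (simp add: stray)
  also have "\<dots> = ?v c * row_weight n t x y T B j c c"
    using assms(6) by simp
  also have "row_weight n t x y T B j c c = (if \<forall>k\<in>{1..j}. B k = T k then prod ?f {1..j} else 0)"
    by (rule Suc.IH[OF Suc.prems(1)[OF sub] disj Suc.prems(3)[OF sub]])
  finally show ?case unfolding v all by simp
qed simp

lemma row_weight_through_empty_columns:
  fixes t :: "'a::field"
  assumes "k \<le> j" "\<And>l. l \<in> {k<..j} \<Longrightarrow> T l = {}"
  shows "row_weight n t x y T B j 0 c =
    (if \<forall>l\<in>{k<..j}. B l = {} then row_weight n t x y T B k 0 c else 0)"
  using assms
proof (induction j)
  case (Suc j)
  show ?case
  proof (cases "k = Suc j")
    case False
    then have k: "k \<le> j" using Suc.prems(1) by simp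
    let ?v = "\<lambda>m. vertex_weight t x (y (Suc j)) (spin 0) (T (Suc j)) (spin m) (B (Suc j))"
    have "T (Suc j) = {}" using Suc.prems(2)[of "Suc j"] k by simp
    then have v: "?v m = (if m = 0 \<and> B (Suc j) = {} then 1 else 0)" for m
      by (simp add: vertex_weight_def spin_def)
    have "row_weight n t x y T B (Suc j) 0 c
        = (\<Sum>m\<le>n. if m = 0 then (if B (Suc j) = {} then row_weight n t x y T B j 0 c else 0) else 0)"
      unfolding row_weight.simps v by (intro sum.cong refl) simp
    also have "\<dots> = (if B (Suc j) = {} then row_weight n t x y T B j 0 c else 0)"
      by simp
    also have "row_weight n t x y T B j 0 c
        = (if \<forall>l\<in>{k<..j}. B l = {} then row_weight n t x y T B k 0 c else 0)"
      using Suc.prems(2) by (intro Suc.IH k) simp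
    moreover have "{k<..Suc j} = insert (Suc j) {k<..j}" using k by auto
    ultimately show ?thesis by simp
  qed simp
qed simp

text \<open>
  The columns \<open>1, \<dots>, k\<close> still carry their colors, and the color of column \<open>k\<close> must leave. The empty
  columns to its left are passed uncolored, in column \<open>k\<close> it has to turn, and then it runs straight.
\<close>

lemma row_weight_staircase:
  fixes t :: "'a::field"
  assumes t: "t \<noteq> 0" and \<sigma>: "\<sigma> permutes {1..n}" and k: "k \<in> {1..n}"
  shows "row_weight n t x y (\<lambda>j. if j \<le> k then {\<sigma> j} else {}) B n 0 (\<sigma> k) =
    (if \<forall>j\<in>{1..n}. B j = (if j < k then {\<sigma> j} else {})
     then \<Prod>j\<in>{1..<k}. t ^ (if \<sigma> k < \<sigma> j then 1 else 0) * (1 - x / y j) else 0)"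
proof -
  define T where "T = (\<lambda>j. if j \<le> k then {\<sigma> j} else {})"
  obtain p where p: "k = Suc p" using k by (cases k) auto
  have inj: "\<sigma> i = \<sigma> j \<longleftrightarrow> i = j" for i j
    using permutes_inj[OF \<sigma>] by (simp add: inj_eq)
  have \<sigma>_in: "\<sigma> j \<in> {1..n}" if "j \<in> {1..n}" for j using permutes_in_image[OF \<sigma>] that by simp
  have sub: "T j \<subseteq> {1..n}" if "j \<in> {1..p}" for j using that p k \<sigma>_in[of j] by (auto simp: T_def)
  have disj: "disjoint_family_on T {1..p}" by (auto simp: disjoint_family_on_def T_def inj)
  have zero: "0 \<notin> T j" if "j \<in> {1..p}" for j using sub[OF that] by auto
  have notin: "\<sigma> k \<notin> T j" if "j \<in> {1..p}" for j using that p by (auto simp: T_def inj)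
  have c: "0 < \<sigma> k" "\<sigma> k \<le> n" using \<sigma>_in[OF k] by auto
  let ?v = "\<lambda>m. vertex_weight t x (y k) (spin 0) (T k) (spin m) (B k)"
  have v: "?v m * row_weight n t x y T B p m (\<sigma> k)
     = (if m = \<sigma> k then (if B k = {} then row_weight n t x y T B p m (\<sigma> k) else 0) else 0)" for m
  proof -
    consider "m = 0" | "m = \<sigma> k" | "m \<noteq> 0" "m \<noteq> \<sigma> k" by blast
    then show ?thesis
    proof cases
      case 1
      have "row_weight n t x y T B p 0 (\<sigma> k) = 0"
        by (rule row_weight_stray_exit[OF t sub disj zero notin c(1)]) (use c in auto)
      then show ?thesis using 1 c by simp
    next
      case 2
      have none: "{e. e = \<sigma> k \<and> e < \<sigma> k} = {}" "{e. e = \<sigma> k \<and> \<sigma> k < e} = {}" by auto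
      have "?v m = (if B k = {} then 1 else 0)"
        using 2 c(1) by (simp add: vertex_weight_def spin_def T_def none)
      then show ?thesis using 2 by simp
    next
      case 3
      then have "?v m = 0" by (simp add: vertex_weight_def spin_def T_def)
      then show ?thesis using 3 by simp
    qed
  qed
  have "row_weight n t x y T B k 0 (\<sigma> k) = (\<Sum>m\<le>n. ?v m * row_weight n t x y T B p m (\<sigma> k))"
    by (simp add: p)
  also have "\<dots> = (if B k = {} then row_weight n t x y T B p (\<sigma> k) (\<sigma> k) else 0)"
    unfolding v using c by simp
  also have "row_weight n t x y T B p (\<sigma> k) (\<sigma> k) = (if \<forall>j\<in>{1..p}. B j = T j
      then \<Prod>j\<in>{1..p}. t ^ card {e \<in> T j. \<sigma> k < e} * (1 - x / y j) else 0)"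
    by (rule row_weight_through[OF t sub disj notin c])
  also have "(\<Prod>j\<in>{1..p}. t ^ card {e \<in> T j. \<sigma> k < e} * (1 - x / y j))
     = (\<Prod>j\<in>{1..<k}. t ^ (if \<sigma> k < \<sigma> j then 1 else 0) * (1 - x / y j))"
  proof (rule prod.cong)
    fix j assume j: "j \<in> {1..<k}"
    have "card {e \<in> T j. \<sigma> k < e} = (if \<sigma> k < \<sigma> j then 1 else 0)"
    proof -
      have "{e \<in> T j. \<sigma> k < e} = (if \<sigma> k < \<sigma> j then {\<sigma> j} else {})" using j by (auto simp: T_def)
      then show ?thesis by simp
    qed
    then show "t ^ card {e \<in> T j. \<sigma> k < e} * (1 - x / y j)
        = t ^ (if \<sigma> k < \<sigma> j then 1 else 0) * (1 - x / y j)" by simp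
  qed (use p in auto)
  finally have at_k: "row_weight n t x y T B k 0 (\<sigma> k) = (if B k = {} then if \<forall>j\<in>{1..p}. B j = T j
      then \<Prod>j\<in>{1..<k}. t ^ (if \<sigma> k < \<sigma> j then 1 else 0) * (1 - x / y j) else 0 else 0)" .
  have "row_weight n t x y T B n 0 (\<sigma> k)
      = (if \<forall>l\<in>{k<..n}. B l = {} then row_weight n t x y T B k 0 (\<sigma> k) else 0)"
    using k by (intro row_weight_through_empty_columns) (auto simp: T_def)
  moreover have "(\<forall>j\<in>{1..n}. B j = (if j < k then {\<sigma> j} else {})) \<longleftrightarrow>
     (\<forall>l\<in>{k<..n}. B l = {}) \<and> B k = {} \<and> (\<forall>j\<in>{1..p}. B j = T j)"
  proof -
    have "{1..n} = {k<..n} \<union> {k} \<union> {1..p}" using k p by auto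
    then have "(\<forall>j\<in>{1..n}. B j = (if j < k then {\<sigma> j} else {})) \<longleftrightarrow>
      (\<forall>j\<in>{k<..n}. B j = (if j < k then {\<sigma> j} else {})) \<and> B k = {} \<and>
      (\<forall>j\<in>{1..p}. B j = (if j < k then {\<sigma> j} else {}))"
      by (simp only: ball_Un) simp
    also have "(\<forall>j\<in>{k<..n}. B j = (if j < k then {\<sigma> j} else {})) \<longleftrightarrow> (\<forall>l\<in>{k<..n}. B l = {})"
      by (intro ball_cong) auto
    also have "(\<forall>j\<in>{1..p}. B j = (if j < k then {\<sigma> j} else {})) \<longleftrightarrow> (\<forall>j\<in>{1..p}. B j = T j)"
      using p by (intro ball_cong) (auto simp: T_def)
    finally show ?thesis .
  qed
  ultimately show ?thesis unfolding T_def[symmetric] at_k by simp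
qed

text \<open>
  Row by row, the preceding lemma determines the vertical spins: after row \<open>i\<close> exactly the columns
  \<open>j \<le> n - i\<close> still carry their colors.
\<close>

lemma partition_fun_reversed:
  fixes t :: "'a::field"
  assumes t: "t \<noteq> 0" and \<sigma>: "\<sigma> permutes {1..n}"
  shows "partition_fun n t \<sigma> (\<sigma> \<circ> w0 n) x y =
    (\<Prod>i\<in>{1..n}. \<Prod>j\<in>{1..<n + 1 - i}.
       t ^ (if \<sigma> (n + 1 - i) < \<sigma> j then 1 else 0) * (1 - x i / y j))"
proof -
  define st where "st i j = (if i + j \<le> n then {\<sigma> j} else {})" for i j
  let ?V = "Pi\<^sub>E {0..n} (\<lambda>i. Pi\<^sub>E {1..n} (levels n \<sigma> i))"
  let ?r = "\<lambda>V i. row_weight n t (x i) y (V (i - 1)) (V i) n 0 ((\<sigma> \<circ> w0 n) i)"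
  let ?F = "\<lambda>i. \<Prod>j\<in>{1..<n + 1 - i}. t ^ (if \<sigma> (n + 1 - i) < \<sigma> j then 1 else 0) * (1 - x i / y j)"
  define W where "W = (\<lambda>i\<in>{0..n}. \<lambda>j\<in>{1..n}. st i j)"
  have \<sigma>_in: "\<sigma> j \<in> {1..n}" if "j \<in> {1..n}" for j using permutes_in_image[OF \<sigma>] that by simp
  have w0: "w0 n i = n + 1 - i" "w0 n i \<in> {1..n}" if "i \<in> {1..n}" for i
    using that by (auto simp: w0_def)
  have row: "?r V i = (if \<forall>j\<in>{1..n}. V i j = st i j then ?F i else 0)"
    if i: "i \<in> {1..n}" and prev: "\<And>j. j \<in> {1..n} \<Longrightarrow> V (i - 1) j = st (i - 1) j" for V i
  proof -
    let ?k = "n + 1 - i"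
    have k: "?k \<in> {1..n}" using i by auto
    have "?r V i = row_weight n t (x i) y (\<lambda>j. if j \<le> ?k then {\<sigma> j} else {}) (V i) n 0 (\<sigma> ?k)"
    proof -
      have "V (i - 1) j = (if j \<le> ?k then {\<sigma> j} else {})" if "j \<in> {1..n}" for j
      proof -
        have "i - 1 + j \<le> n \<longleftrightarrow> j \<le> ?k" using i by auto
        then show ?thesis unfolding prev[OF that] st_def by simp
      qed
      then show ?thesis unfolding comp_apply w0(1)[OF i] by (intro row_weight_cong) simp
    qed
    also have "\<dots> = (if \<forall>j\<in>{1..n}. V i j = (if j < ?k then {\<sigma> j} else {}) then ?F i else 0)"
      by (rule row_weight_staircase[OF t \<sigma> k])
    also have "(\<forall>j\<in>{1..n}. V i j = (if j < ?k then {\<sigma> j} else {})) \<longleftrightarrow> (\<forall>j\<in>{1..n}. V i j = st i j)"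
      using i by (intro ball_cong) (auto simp: st_def)
    finally show ?thesis .
  qed
  have unique: "V i j = st i j" if V: "V \<in> ?V" and nz: "\<And>i. i \<in> {1..n} \<Longrightarrow> ?r V i \<noteq> 0"
    and ij: "i \<le> n" "j \<in> {1..n}" for V i j
    using ij
  proof (induction i arbitrary: j)
    case 0
    have "V 0 \<in> Pi\<^sub>E {1..n} (levels n \<sigma> 0)" using V by (rule PiE_mem) simp
    then have "V 0 j \<in> levels n \<sigma> 0 j" using 0(2) by (rule PiE_mem)
    then show ?case using 0 by (simp add: levels_def st_def)
  next
    case (Suc i)
    have i: "Suc i \<in> {1..n}" using Suc.prems by simp
    have prev: "V (Suc i - 1) l = st (Suc i - 1) l" if "l \<in> {1..n}" for l
      using Suc.IH[OF _ that] Suc.prems by simp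
    have "?r V (Suc i) = (if \<forall>j\<in>{1..n}. V (Suc i) j = st (Suc i) j then ?F (Suc i) else 0)"
      by (rule row[of "Suc i" V, OF i prev])
    with nz[OF i] have "\<forall>j\<in>{1..n}. V (Suc i) j = st (Suc i) j" by presburger
    then show ?case using Suc.prems(2) by blast
  qed
  have W_eq: "W i j = st i j" if "i \<le> n" "j \<in> {1..n}" for i j using that by (simp add: W_def)
  have W_in: "W \<in> ?V"
  proof -
    have "st i j \<in> levels n \<sigma> i j" if "i \<in> {0..n}" "j \<in> {1..n}" for i j
      using that \<sigma>_in[OF that(2)] by (auto simp: st_def levels_def)
    then show ?thesis unfolding W_def by simp
  qed
  have other: "(\<Prod>i\<in>{1..n}. ?r V i) = 0" if V: "V \<in> ?V - {W}" for V
  proof (rule ccontr)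
    assume "(\<Prod>i\<in>{1..n}. ?r V i) \<noteq> 0"
    then have nz: "?r V i \<noteq> 0" if "i \<in> {1..n}" for i using that by auto
    have "V = W"
    proof (rule PiE_ext)
      show "V \<in> ?V" "W \<in> ?V" using V W_in by simp_all
      fix i assume i: "i \<in> {0..n}"
      show "V i = W i"
      proof (rule PiE_ext)
        show "V i \<in> Pi\<^sub>E {1..n} (levels n \<sigma> i)" by (rule PiE_mem[OF _ i]) (use V in simp)
        show "W i \<in> Pi\<^sub>E {1..n} (levels n \<sigma> i)" by (rule PiE_mem[OF W_in i])
        fix j assume j: "j \<in> {1..n}"
        have "V i j = st i j" using V i j by (intro unique nz) auto
        then show "V i j = W i j" using W_eq i j by simp
      qed
    qed
    with V show False by simp
  qed
  have "partition_fun n t \<sigma> (\<sigma> \<circ> w0 n) x y = (\<Sum>V\<in>?V. \<Prod>i\<in>{1..n}. ?r V i)"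
    by (rule partition_fun_rows) (use \<sigma>_in w0(2) in simp_all)
  also have "\<dots> = (\<Sum>V\<in>{W}. \<Prod>i\<in>{1..n}. ?r V i)"
  proof (rule sum.mono_neutral_right)
    show "finite ?V" by (intro finite_PiE) (auto simp: levels_def)
  qed (use W_in other in auto)
  also have "\<dots> = (\<Prod>i\<in>{1..n}. ?F i)"
  proof -
    have "?r W i = ?F i" if i: "i \<in> {1..n}" for i
    proof -
      have le: "i \<le> n" "i - 1 \<le> n" using i by auto
      have prev: "W (i - 1) j = st (i - 1) j" if "j \<in> {1..n}" for j by (rule W_eq[OF le(2) that])
      from row[of i W, OF i prev] show ?thesis by (simp add: W_eq[OF le(1)])
    qed
    then show ?thesis by simp
  qed
  finally show ?thesis .
qed

section \<open>Length, inversions and descents\<close>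

definition inversion_set :: "nat \<Rightarrow> (nat \<Rightarrow> nat) \<Rightarrow> (nat \<times> nat) set" where
  "inversion_set n w = {(i, j). i \<in> {1..n} \<and> j \<in> {1..n} \<and> i < j \<and> w j < w i}"

lemma finite_inversion_set [simp]: "finite (inversion_set n w)"
  by (rule finite_subset[of _ "{1..n} \<times> {1..n}"]) (auto simp: inversion_set_def)

lemma simple_refl_simps [simp]:
  "simple_refl i i = Suc i" "simple_refl i (Suc i) = i"
  "k \<noteq> i \<Longrightarrow> k \<noteq> Suc i \<Longrightarrow> simple_refl i k = k"
  "simple_refl i (simple_refl i k) = k" "simple_refl i \<circ> simple_refl i = id"
  by (simp_all add: simple_refl_def)

lemma simple_refl_permutes: "i \<in> {1..<n} \<Longrightarrow> simple_refl i permutes {1..n}"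
  unfolding simple_refl_def by (rule permutes_swap_id) auto

lemma simple_refl_in: "i \<in> {1..<n} \<Longrightarrow> simple_refl i k \<in> {1..n} \<longleftrightarrow> k \<in> {1..n}"
  by (rule permutes_in_image[OF simple_refl_permutes])

lemma simple_refl_less:
  "a < b \<Longrightarrow> (a, b) \<noteq> (i, Suc i) \<Longrightarrow> simple_refl i a < simple_refl i b"
  by (auto simp: simple_refl_def transpose_def)

text \<open>
  Exchanging the values at the positions \<open>i\<close> and \<open>i + 1\<close> transports all inversions except
  the pair \<open>(i, i + 1)\<close>, because the transposition preserves the order of every other pair.
\<close>

lemma card_inversion_set_descent:
  assumes i: "i \<in> {1..<n}" and desc: "w (Suc i) < w i"
  shows "card (inversion_set n w) = Suc (card (inversion_set n (w \<circ> simple_refl i)))"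
proof -
  let ?s = "simple_refl i"
  have "bij_betw (map_prod ?s ?s) (inversion_set n w - {(i, Suc i)}) (inversion_set n (w \<circ> ?s))"
  proof (rule bij_betw_byWitness[where f' = "map_prod ?s ?s"])
    show "map_prod ?s ?s ` (inversion_set n w - {(i, Suc i)}) \<subseteq> inversion_set n (w \<circ> ?s)"
    proof
      fix p assume "p \<in> map_prod ?s ?s ` (inversion_set n w - {(i, Suc i)})"
      then obtain a b where p: "p = (?s a, ?s b)"
        and ab: "a \<in> {1..n}" "b \<in> {1..n}" "a < b" "w b < w a" "(a, b) \<noteq> (i, Suc i)"
        by (auto simp: inversion_set_def)
      have "?s a < ?s b" "?s a \<in> {1..n}" "?s b \<in> {1..n}"
        using ab simple_refl_less[of a b i] simple_refl_in[OF i] by blast+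
      then show "p \<in> inversion_set n (w \<circ> ?s)"
        using ab(4) unfolding p inversion_set_def by simp
    qed
    show "map_prod ?s ?s ` inversion_set n (w \<circ> ?s) \<subseteq> inversion_set n w - {(i, Suc i)}"
    proof
      fix p assume "p \<in> map_prod ?s ?s ` inversion_set n (w \<circ> ?s)"
      then obtain a b where p: "p = (?s a, ?s b)"
        and ab: "a \<in> {1..n}" "b \<in> {1..n}" "a < b" "w (?s b) < w (?s a)"
        by (auto simp: inversion_set_def)
      have "(a, b) \<noteq> (i, Suc i)" using ab(4) desc by auto
      then have "?s a < ?s b" using ab(3) simple_refl_less by blast
      moreover have "(?s a, ?s b) \<noteq> (i, Suc i)"
      proof
        assume "(?s a, ?s b) = (i, Suc i)"
        then have "a = Suc i" "b = i" by (metis prod.inject simple_refl_simps(1,2,4))+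
        with ab(3) show False by simp
      qed
      ultimately show "p \<in> inversion_set n w - {(i, Suc i)}"
        using ab simple_refl_in[OF i] unfolding p inversion_set_def by blast
    qed
  qed auto
  then have "card (inversion_set n w - {(i, Suc i)}) = card (inversion_set n (w \<circ> ?s))"
    by (rule bij_betw_same_card)
  moreover have "(i, Suc i) \<in> inversion_set n w" using i desc by (auto simp: inversion_set_def)
  ultimately show ?thesis
    by (metis card_Suc_Diff1 finite_inversion_set)
qed

lemma card_inversion_set_ascent:
  assumes "i \<in> {1..<n}" "w i < w (Suc i)"
  shows "card (inversion_set n (w \<circ> simple_refl i)) = Suc (card (inversion_set n w))"
proof -
  have "w \<circ> simple_refl i \<circ> simple_refl i = w" by (simp add: comp_assoc)
  then show ?thesis
    using card_inversion_set_descent[of i n "w \<circ> simple_refl i"] assms by simp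
qed

lemma descent_or_ascent:
  assumes "w permutes {1..n}"
  shows "w (Suc i) < w i \<or> w i < w (Suc i)"
  using permutes_inj[OF assms] by (metis injD linorder_neqE_nat n_not_Suc_n)

lemma word_prod_append [simp]: "word_prod (is @ js) = word_prod is \<circ> word_prod js"
  by (induction "is") (simp_all add: word_prod_def comp_assoc)

lemma word_prod_simps [simp]:
  "word_prod [] = id" "word_prod (i # is) = simple_refl i \<circ> word_prod is"
  by (simp_all add: word_prod_def)

lemma word_prod_permutes: "set is \<subseteq> {1..<n} \<Longrightarrow> word_prod is permutes {1..n}"
proof (induction "is")
  case (Cons i "is")
  then have "word_prod is permutes {1..n}" "simple_refl i permutes {1..n}"
    using simple_refl_permutes[of i n] by simp_all
  then show ?case unfolding word_prod_simps by (rule permutes_compose)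
qed (simp add: permutes_id)

lemma card_inversion_set_word_prod:
  "set is \<subseteq> {1..<n} \<Longrightarrow> card (inversion_set n (word_prod is)) \<le> length is"
proof (induction "is" rule: rev_induct)
  case Nil
  have "inversion_set n (word_prod []) = {}" by (auto simp: inversion_set_def)
  then show ?case by (simp only: card.empty le0)
next
  case (snoc i "is")
  let ?v = "word_prod is"
  have i: "i \<in> {1..<n}" and "is": "set is \<subseteq> {1..<n}" using snoc.prems by auto
  have "card (inversion_set n (?v \<circ> simple_refl i)) \<le> Suc (card (inversion_set n ?v))"
    using descent_or_ascent[OF word_prod_permutes[OF "is"], of i]
      card_inversion_set_descent[OF i, of ?v] card_inversion_set_ascent[OF i, of ?v] by linarith
  moreover have "word_prod (is @ [i]) = ?v \<circ> simple_refl i"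
    by (simp only: word_prod_append word_prod_simps comp_id)
  ultimately show ?case using snoc.IH[OF "is"] by (simp only: length_append_singleton)
qed

text \<open>
  Increasing values force \<open>j \<le> w j\<close> from the left end and \<open>w j \<le> j\<close> from the right end.
\<close>

lemma permutation_without_descents:
  assumes w: "w permutes {1..n}" and asc: "\<And>i. i \<in> {1..<n} \<Longrightarrow> w i < w (Suc i)"
  shows "w = id"
proof
  fix k
  show "w k = id k"
  proof (cases "k \<in> {1..n}")
    case True
    have in_range: "w j \<in> {1..n}" if "j \<in> {1..n}" for j
      using permutes_in_image[OF w] that by simp
    have ge: "j \<in> {1..n} \<longrightarrow> j \<le> w j" for j
    proof (induction j)
      case (Suc j)
      show ?case
      proof (cases "j = 0")
        case True
        then show ?thesis using in_range[of 1] by auto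
      next
        case False
        show ?thesis
        proof
          assume "Suc j \<in> {1..n}"
          with False have "j \<in> {1..<n}" "j \<in> {1..n}" by auto
          with Suc asc[of j] show "Suc j \<le> w (Suc j)" by linarith
        qed
      qed
    qed simp
    have le: "m < n \<longrightarrow> w (n - m) \<le> n - m" for m
    proof (induction m)
      case 0
      show ?case using in_range[of n] by auto
    next
      case (Suc m)
      show ?case
      proof
        assume m: "Suc m < n"
        then have "n - Suc m \<in> {1..<n}" "Suc (n - Suc m) = n - m" by auto
        with asc[of "n - Suc m"] Suc m show "w (n - Suc m) \<le> n - Suc m" by auto
      qed
    qed
    have "k \<le> w k" using ge True by blast
    moreover have "w k \<le> k" using le[of "n - k"] True by auto
    ultimately show ?thesis by simp
  next
    case False
    then show ?thesis using permutes_not_in[OF w] by simp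
  qed
qed

text \<open>
  Remove descents one at a time; each removal costs one inversion.
\<close>

lemma exists_reduced_word:
  assumes "w permutes {1..n}"
  shows "\<exists>is. set is \<subseteq> {1..<n} \<and> word_prod is = w \<and> length is = card (inversion_set n w)"
  using assms
proof (induction "card (inversion_set n w)" arbitrary: w rule: less_induct)
  case less
  show ?case
  proof (cases "\<exists>i\<in>{1..<n}. w (Suc i) < w i")
    case True
    then obtain i where i: "i \<in> {1..<n}" "w (Suc i) < w i" by blast
    have c: "card (inversion_set n w) = Suc (card (inversion_set n (w \<circ> simple_refl i)))"
      by (rule card_inversion_set_descent[OF i])
    have "w \<circ> simple_refl i permutes {1..n}"
      by (rule permutes_compose[OF simple_refl_permutes[OF i(1)] less.prems])
    then obtain "is" where "is": "set is \<subseteq> {1..<n}" "word_prod is = w \<circ> simple_refl i"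
      "length is = card (inversion_set n (w \<circ> simple_refl i))"
      using less.hyps[of "w \<circ> simple_refl i"] c by auto
    have "word_prod (is @ [i]) = w" by (simp add: "is"(2) comp_assoc)
    with "is" i c show ?thesis by (intro exI[of _ "is @ [i]"]) auto
  next
    case False
    then have "w i < w (Suc i)" if "i \<in> {1..<n}" for i
      using descent_or_ascent[OF less.prems, of i] that by blast
    then have "w = id" by (rule permutation_without_descents[OF less.prems])
    moreover have "inversion_set n id = {}" by (auto simp: inversion_set_def)
    ultimately show ?thesis by (intro exI[of _ "[]"]) simp
  qed
qed

lemma perm_length_eq_card_inversion_set:
  assumes "w permutes {1..n}"
  shows "perm_length n w = card (inversion_set n w)"
  unfolding perm_length_def
proof (rule Least_equality)
  show "\<exists>is. length is = card (inversion_set n w) \<and> set is \<subseteq> {1..<n} \<and> word_prod is = w"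
    using exists_reduced_word[OF assms] by blast
  show "card (inversion_set n w) \<le> k" if "\<exists>is. length is = k \<and> set is \<subseteq> {1..<n} \<and> word_prod is = w" for k
    using that card_inversion_set_word_prod by blast
qed

lemma perm_length_descent:
  assumes "w permutes {1..n}" "i \<in> {1..<n}" "w (Suc i) < w i"
  shows "perm_length n w = Suc (perm_length n (w \<circ> simple_refl i))"
  using card_inversion_set_descent[OF assms(2,3)] assms(1)
    permutes_compose[OF simple_refl_permutes[OF assms(2)] assms(1)]
  by (simp add: perm_length_eq_card_inversion_set)

lemma bruhat_less_imp_perm_length_less: "bruhat_less n v w \<Longrightarrow> perm_length n v < perm_length n w"
  by (induction rule: bruhat_less.induct) (assumption, rule less_trans)

text \<open>
  Bruhat comparisons with a simple reflection are decided by length alone, hence by the descent.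
\<close>

lemma bruhat_less_simple_refl_iff:
  assumes w: "w permutes {1..n}" and i: "i \<in> {1..<n}"
  shows "bruhat_less n (w \<circ> simple_refl i) w \<longleftrightarrow> w (Suc i) < w i"
proof
  assume desc: "w (Suc i) < w i"
  let ?v = "w \<circ> simple_refl i"
  have v: "?v permutes {1..n}" by (rule permutes_compose[OF simple_refl_permutes[OF i] w])
  have e: "?v \<circ> transpose i (Suc i) = w"
    using simple_refl_simps(5)[of i] by (simp add: comp_assoc simple_refl_def)
  have "bruhat_less n ?v (?v \<circ> transpose i (Suc i))"
    using v i perm_length_descent[OF w i desc] by (intro bruhat_less.step) (auto simp: e)
  then show "bruhat_less n ?v w" by (simp only: e)
next
  assume "bruhat_less n (w \<circ> simple_refl i) w"
  then have less: "perm_length n (w \<circ> simple_refl i) < perm_length n w"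
    by (rule bruhat_less_imp_perm_length_less)
  show "w (Suc i) < w i"
  proof (rule ccontr)
    assume "\<not> w (Suc i) < w i"
    then have asc: "w i < w (Suc i)" using descent_or_ascent[OF w, of i] by blast
    have v: "w \<circ> simple_refl i permutes {1..n}"
      by (rule permutes_compose[OF simple_refl_permutes[OF i] w])
    show False
      using less card_inversion_set_ascent[OF i asc]
      by (simp add: perm_length_eq_card_inversion_set[OF w] perm_length_eq_card_inversion_set[OF v])
  qed
qed

lemma w0_simps: "i \<in> {1..n} \<Longrightarrow> w0 n i = n + 1 - i" "w0 n (w0 n i) = i" "w0 n i \<in> {1..n} \<longleftrightarrow> i \<in> {1..n}"
  by (auto simp: w0_def)

lemma w0_permutes: "w0 n permutes {1..n}"
  by (rule bij_imp_permutes) (auto intro!: bij_betw_byWitness[where f' = "w0 n"] simp: w0_simps(2), auto simp: w0_def)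

lemma perm_length_w0: "perm_length n (w0 n) = card {(i, j). i \<in> {1..n} \<and> j \<in> {1..n} \<and> i < j}"
  unfolding perm_length_eq_card_inversion_set[OF w0_permutes] inversion_set_def
  by (intro arg_cong[where f = card]) (auto simp: w0_def)

text \<open>
  Every pair of positions is an inversion of exactly one of \<open>u\<close> and, after reversal, \<open>u w\<^sub>0\<close>.
\<close>

lemma perm_length_comp_w0:
  assumes u: "u permutes {1..n}"
  shows "perm_length n u + perm_length n (u \<circ> w0 n) = perm_length n (w0 n)"
proof -
  let ?A = "{(i, j). i \<in> {1..n} \<and> j \<in> {1..n} \<and> i < j \<and> u i < u j}"
  let ?f = "\<lambda>(i, j). (w0 n j, w0 n i)"
  have uw: "u \<circ> w0 n permutes {1..n}" by (rule permutes_compose[OF w0_permutes u])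
  have "bij_betw ?f (inversion_set n (u \<circ> w0 n)) ?A"
  proof (rule bij_betw_byWitness[where f' = ?f])
    show "?f ` inversion_set n (u \<circ> w0 n) \<subseteq> ?A"
      by (auto simp: inversion_set_def w0_def split: if_splits)
    show "?f ` ?A \<subseteq> inversion_set n (u \<circ> w0 n)"
    proof
      fix p assume "p \<in> ?f ` ?A"
      then obtain i j where p: "p = (w0 n j, w0 n i)" and ij: "i \<in> {1..n}" "j \<in> {1..n}" "i < j" "u i < u j"
        by auto
      have "w0 n j < w0 n i" using ij by (auto simp: w0_def)
      moreover have "w0 n i \<in> {1..n}" "w0 n j \<in> {1..n}" using ij w0_simps(3) by blast+
      ultimately show "p \<in> inversion_set n (u \<circ> w0 n)"
        using ij by (simp add: p inversion_set_def w0_simps(2))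
    qed
  qed (auto simp: w0_simps(2))
  then have "card (inversion_set n (u \<circ> w0 n)) = card ?A" by (rule bij_betw_same_card)
  moreover have "card (inversion_set n u) + card ?A = card (inversion_set n u \<union> ?A)"
    by (intro card_Un_disjoint[symmetric] finite_inversion_set)
      (auto simp: inversion_set_def intro: finite_subset[of _ "{1..n} \<times> {1..n}"])
  moreover have "inversion_set n u \<union> ?A = {(i, j). i \<in> {1..n} \<and> j \<in> {1..n} \<and> i < j}"
  proof -
    have "u i \<noteq> u j" if "i < j" for i j using permutes_inj[OF u] that by (metis injD less_irrefl)
    then show ?thesis by (auto simp: inversion_set_def) (metis linorder_neqE_nat)
  qed
  ultimately show ?thesis
    unfolding perm_length_w0 perm_length_eq_card_inversion_set[OF u] perm_length_eq_card_inversion_set[OF uw]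
    by simp
qed

section \<open>The operators on rational functions\<close>

lemma swap_ratfun_0 [simp]: "swap_ratfun i 0 = 0"
  by (simp add: Zero_fract_def swap_ratfun_Fract)

lemma swap_ratfun_1 [simp]: "swap_ratfun i 1 = 1"
  by (simp add: One_fract_def swap_ratfun_Fract)

lemma swap_ratfun_minus: "swap_ratfun i (- f) = - swap_ratfun i f"
  using swap_ratfun_add[of i f "- f"] by (simp add: minus_unique)

lemma swap_ratfun_diff: "swap_ratfun i (f - g) = swap_ratfun i f - swap_ratfun i g"
  using swap_ratfun_add[of i f "- g"] by (simp add: swap_ratfun_minus)

lemma swap_ratfun_inverse: "swap_ratfun i (inverse f) = inverse (swap_ratfun i f)"
proof (cases "f = 0")
  case False
  then have "swap_ratfun i f * swap_ratfun i (inverse f) = 1"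
    by (simp flip: swap_ratfun_mult)
  then show ?thesis by (metis inverse_unique)
qed simp

lemma swap_ratfun_divide: "swap_ratfun i (f / g) = swap_ratfun i f / swap_ratfun i g"
  by (simp add: divide_inverse swap_ratfun_mult swap_ratfun_inverse)

lemma swap_ratfun_power: "swap_ratfun i (f ^ k) = swap_ratfun i f ^ k"
  by (induction k) (simp_all add: swap_ratfun_mult)

lemma swap_ratfun_power_int: "swap_ratfun i (f powi k) = swap_ratfun i f powi k"
  by (simp add: power_int_def swap_ratfun_power swap_ratfun_inverse)

lemma swap_ratfun_sum: "swap_ratfun i (sum f A) = (\<Sum>a\<in>A. swap_ratfun i (f a))"
  by (induction A rule: infinite_finite_induct) (simp_all add: swap_ratfun_add)

lemma swap_ratfun_prod: "swap_ratfun i (prod f A) = (\<Prod>a\<in>A. swap_ratfun i (f a))"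
  by (induction A rule: infinite_finite_induct) (simp_all add: swap_ratfun_mult)

lemma swap_ratfun_swap_ratfun [simp]: "swap_ratfun i (swap_ratfun i f) = f"
  by (cases f) (simp add: swap_ratfun_Fract)

lemmas swap_ratfun_hom = swap_ratfun_add swap_ratfun_mult swap_ratfun_minus swap_ratfun_diff
  swap_ratfun_inverse swap_ratfun_divide swap_ratfun_power swap_ratfun_power_int
  swap_ratfun_sum swap_ratfun_prod swap_ratfun_xv swap_ratfun_yv swap_ratfun_qh

lemma swap_ratfun_qv: "swap_ratfun i qv = qv"
  by (simp add: qv_def swap_ratfun_hom)

lemma swap_ratfun_tv: "swap_ratfun i tv = tv"
  by (simp add: tv_def swap_ratfun_qv swap_ratfun_hom)

lemma swap_ratfun_vertex_weight:
  "swap_ratfun i (vertex_weight t x y L S R S')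
    = vertex_weight (swap_ratfun i t) (swap_ratfun i x) (swap_ratfun i y) L S R S'"
  by (cases L; cases R) (simp_all add: vertex_weight_def swap_ratfun_hom)

lemma swap_ratfun_partition_fun:
  "swap_ratfun i (partition_fun n t \<sigma> w x y)
    = partition_fun n (swap_ratfun i t) \<sigma> w (swap_ratfun i \<circ> x) (swap_ratfun i \<circ> y)"
  by (simp add: partition_fun_def swap_ratfun_sum swap_ratfun_prod swap_ratfun_vertex_weight
      case_prod_unfold)

lemma indet_poly_eq_iff: "(indet_poly a :: 'k::field mpoly) = indet_poly b \<longleftrightarrow> a = b"
proof
  assume eq: "(indet_poly a :: 'k mpoly) = indet_poly b"
  have "Poly_Mapping.lookup (indet_poly a :: 'k mpoly) (Poly_Mapping.single a 1) = 1"
    by (simp add: indet_poly_def)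
  then have "Poly_Mapping.lookup (indet_poly b :: 'k mpoly) (Poly_Mapping.single a 1) = 1"
    by (simp only: eq)
  then have "Poly_Mapping.single b (1::nat) = Poly_Mapping.single a 1"
    by (simp add: indet_poly_def lookup_single when_def split: if_splits)
  then have "Poly_Mapping.lookup (Poly_Mapping.single b (1::nat)) a = 1" by simp
  then show "a = b" by (simp add: lookup_single when_def split: if_splits)
qed simp

lemma indet_poly_nonzero: "(indet_poly a :: 'k::field mpoly) \<noteq> 0"
  by (metis indet_poly_def keys_single keys_zero one_neq_zero insert_not_empty)

lemma xv_nonzero [simp]: "(xv i :: 'k::field ratfun) \<noteq> 0"
  and yv_nonzero [simp]: "(yv i :: 'k::field ratfun) \<noteq> 0"
  and qh_nonzero [simp]: "(qh :: 'k::field ratfun) \<noteq> 0"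
  by (simp_all add: xv_def yv_def qh_def Zero_fract_def eq_fract indet_poly_nonzero)

lemma tv_nonzero [simp]: "(tv :: 'k::field ratfun) \<noteq> 0"
  by (simp add: tv_def qv_def)

lemma xv_eq_iff: "(xv i :: 'k::field ratfun) = xv j \<longleftrightarrow> i = j"
  by (simp add: xv_def eq_fract indet_poly_eq_iff)

text \<open>
  A factor that is invariant under \<open>s\<^sub>i\<close> is a scalar for \<open>\<tau>\<^sub>i\<close>; all monomial prefactors are
  removed in this way.
\<close>

lemma tau_bar_mult_symmetric: "swap_ratfun i a = a \<Longrightarrow> tau_bar i (a * f) = a * tau_bar i f"
  by (simp add: tau_bar_def Let_def swap_ratfun_mult algebra_simps)

text \<open>
  If \<open>\<tau>\<^sub>i\<close> kills \<open>h\<close>, then \<open>(t - 1) h = (t - X) s\<^sub>i h\<close> with \<open>X = x\<^sub>i\<^sub>+\<^sub>1 / x\<^sub>i\<close>. Applying \<open>s\<^sub>i\<close> once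
  more and eliminating \<open>s\<^sub>i h\<close> leaves \<open>t (X - 1)\<^sup>2 h = 0\<close>.
\<close>

lemma tau_bar_cancel:
  fixes f g :: "'k::field ratfun"
  assumes "tau_bar i f = tau_bar i g"
  shows "f = g"
proof -
  define X :: "'k ratfun" where "X = xv (Suc i) / xv i"
  define h where "h = f - g"
  have X: "X \<noteq> 0" "X \<noteq> 1" by (simp_all add: X_def xv_eq_iff)
  \<comment> \<open>The reflection inverts \<open>X\<close>.\<close>
  have sX: "swap_ratfun i X = 1 / X" by (simp add: X_def swap_ratfun_hom)
  have "((tv - 1) * f + (X - tv) * swap_ratfun i f) / (1 - X)
      = ((tv - 1) * g + (X - tv) * swap_ratfun i g) / (1 - X)"
    using assms by (simp add: tau_bar_def X_def[symmetric] add_divide_distrib)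
  then have "(tv - 1) * f + (X - tv) * swap_ratfun i f = (tv - 1) * g + (X - tv) * swap_ratfun i g"
    using X by simp
  then have h1: "(tv - 1) * h = (tv - X) * swap_ratfun i h"
    by (simp add: h_def swap_ratfun_diff algebra_simps)
  from arg_cong[OF this, of "swap_ratfun i"]
  have h2: "(tv - 1) * swap_ratfun i h = (tv - 1 / X) * h"
    by (simp add: swap_ratfun_hom swap_ratfun_tv sX)
  have "(tv - 1) * ((tv - 1) * h) = (tv - X) * ((tv - 1) * swap_ratfun i h)"
    unfolding h1 by (rule mult.left_commute)
  then have "X * ((tv - 1) * ((tv - 1) * h)) = X * ((tv - X) * ((tv - 1 / X) * h))"
    unfolding h2 by simp
  also have "X * ((tv - X) * ((tv - 1 / X) * h)) = (tv - X) * ((X * tv - 1) * h)"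
  proof -
    have e: "X * (tv - 1 / X) = X * tv - 1" using X(1) by (simp add: right_diff_distrib)
    have "X * ((tv - X) * ((tv - 1 / X) * h)) = (tv - X) * ((X * (tv - 1 / X)) * h)"
      by (simp only: mult_ac)
    then show ?thesis by (simp only: e)
  qed
  finally have "(tv * (X - 1) * (X - 1)) * h = 0"
    by (simp add: algebra_simps)
  then have "h = 0" using X(2) by simp
  then show ?thesis by (simp add: h_def)
qed

lemma monomial_nonzero: "(\<And>i. z i \<noteq> 0) \<Longrightarrow> monomial n z \<mu> \<noteq> 0"
  by (simp add: monomial_def)

lemma M_op_cancel:
  fixes f g :: "'k::field ratfun"
  assumes "M_op n u i f = M_op n u i g"
  shows "f = g"
proof -
  let ?\<mu> = "perm_act (w0 n \<circ> inv u \<circ> w0 n) (rho n)"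
  have nz: "monomial n xv \<nu> \<noteq> (0 :: 'k ratfun)" for \<nu> by (rule monomial_nonzero) simp
  have "tau_bar i (monomial n xv ?\<mu> * f) = tau_bar i (monomial n xv ?\<mu> * g)"
    using assms nz by (simp add: M_op_def Let_def)
  then have "monomial n xv ?\<mu> * f = monomial n xv ?\<mu> * g" by (rule tau_bar_cancel)
  with nz show ?thesis by simp
qed

text \<open>
  The exchange relation at inverted variables: there \<open>s\<^sub>i\<close> acts on the partition function by
  exchanging the parameters of two rows, and multiplying the relation by \<open>x\<^sub>i\<^sub>+\<^sub>1\<close> turns its
  coefficients into those of \<open>\<tau>\<^sub>i\<close>.
\<close>

lemma tau_bar_partition_fun:
  fixes u :: "nat \<Rightarrow> nat"
  assumes u: "u permutes {1..n}" and w: "w permutes {1..n}" and i: "i \<in> {1..<n}" and desc: "w (Suc i) < w i"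
  defines "Z \<equiv> \<lambda>w. partition_fun n tv u w (\<lambda>i. inverse (xv i)) (\<lambda>j. inverse ((yv \<circ> u) j)) :: 'k::field ratfun"
  shows "tau_bar i (Z w) = Z (w \<circ> simple_refl i)"
proof -
  define X :: "'k ratfun" where "X = xv (Suc i) / xv i"
  have X: "1 - X \<noteq> 0" by (simp add: X_def xv_eq_iff)
  have "(inverse (xv i) - tv * inverse (xv (Suc i))) *
      partition_fun n tv u w ((\<lambda>i. inverse (xv i)) \<circ> simple_refl i) (\<lambda>j. inverse ((yv \<circ> u) j))
    = (inverse (xv (Suc i)) - inverse (xv i)) * Z (w \<circ> simple_refl i)
      + (1 - tv) * inverse (xv (Suc i)) * Z w"
    unfolding Z_def by (rule partition_fun_exchange[OF _ _ u w i desc]) simp_all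
  moreover have "partition_fun n tv u w ((\<lambda>i. inverse (xv i)) \<circ> simple_refl i) (\<lambda>j. inverse ((yv \<circ> u) j))
    = swap_ratfun i (Z w)"
    unfolding Z_def by (simp add: swap_ratfun_partition_fun swap_ratfun_hom swap_ratfun_tv comp_def)
  ultimately have eq: "xv (Suc i) * ((inverse (xv i) - tv * inverse (xv (Suc i))) * swap_ratfun i (Z w))
    = xv (Suc i) * ((inverse (xv (Suc i)) - inverse (xv i)) * Z (w \<circ> simple_refl i)
      + (1 - tv) * inverse (xv (Suc i)) * Z w)"
    by simp
  then have "(X - tv) * swap_ratfun i (Z w) = (1 - X) * Z (w \<circ> simple_refl i) + (1 - tv) * Z w"
  proof -
    have coeffs: "xv (Suc i) * (inverse (xv i) - tv * inverse (xv (Suc i))) = X - tv"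
      "xv (Suc i) * (inverse (xv (Suc i)) - inverse (xv i)) = 1 - X"
      "xv (Suc i) * ((1 - tv) * inverse (xv (Suc i))) = 1 - tv"
      by (simp_all add: X_def field_simps)
    have "(xv (Suc i) * (inverse (xv i) - tv * inverse (xv (Suc i)))) * swap_ratfun i (Z w)
      = (xv (Suc i) * (inverse (xv (Suc i)) - inverse (xv i))) * Z (w \<circ> simple_refl i)
        + (xv (Suc i) * ((1 - tv) * inverse (xv (Suc i)))) * Z w"
      using eq by (simp only: distrib_left mult.assoc)
    then show ?thesis by (simp only: coeffs)
  qed
  then have "((tv - 1) * Z w + (X - tv) * swap_ratfun i (Z w)) = (1 - X) * Z (w \<circ> simple_refl i)"
    by (simp add: algebra_simps)
  then have "((tv - 1) * Z w + (X - tv) * swap_ratfun i (Z w)) / (1 - X) = Z (w \<circ> simple_refl i)"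
    using X by simp
  then show ?thesis by (simp add: tau_bar_def X_def[symmetric] add_divide_distrib)
qed

lemma monomial_mult: "(\<And>i. z i \<noteq> 0) \<Longrightarrow> monomial n z \<mu> * monomial n z \<nu> = monomial n z (\<lambda>i. \<mu> i + \<nu> i)"
  by (simp add: monomial_def prod.distrib power_int_add)

lemma monomial_comp_inv:
  assumes v: "v permutes {1..n}"
  shows "monomial n (z \<circ> inv v) \<mu> = monomial n z (\<mu> \<circ> v)"
proof -
  have "monomial n (z \<circ> inv v) \<mu> = (\<Prod>j\<in>{1..n}. z (inv v (v j)) powi \<mu> (v j))"
    unfolding monomial_def using prod.permute[OF v, of "\<lambda>i. (z \<circ> inv v) i powi \<mu> i"] by (simp add: comp_def)
  then show ?thesis by (simp add: monomial_def permutes_inverses(2)[OF v])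
qed

lemma swap_ratfun_monomial_const:
  assumes "i \<in> {1..<n}"
  shows "swap_ratfun i (monomial n xv (\<lambda>_. k)) = (monomial n xv (\<lambda>_. k) :: 'k::field ratfun)"
  using prod.permute[OF simple_refl_permutes[OF assms], of "\<lambda>j. xv j powi k :: 'k ratfun"]
  by (simp add: monomial_def swap_ratfun_hom comp_def)

text \<open>
  Reversal by \<open>w\<^sub>0\<close> turns \<open>\<rho>\<close> into \<open>(n - 1) - \<rho>\<close>; so the conjugating monomial of \<open>M\<^sub>i\<^sup>u\<close> is, up to a
  symmetric factor, inverse to the \<open>x\<close>-part of \<open>r\<close>.
\<close>

lemma exponents_complementary:
  assumes u: "u permutes {1..n}" and j: "j \<in> {1..n}"
  shows "perm_act (w0 n \<circ> inv u \<circ> w0 n) (rho n) j + rho n ((u \<circ> w0 n) j) = int n - 1"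
proof -
  let ?v = "u \<circ> w0 n"
  have inv_w0: "inv (w0 n) = w0 n"
    by (rule inv_equality) (simp_all add: w0_simps(2))
  have "inv (w0 n \<circ> inv u \<circ> w0 n) = inv (w0 n) \<circ> (inv (inv u) \<circ> inv (w0 n))"
    using permutes_bij[OF w0_permutes] permutes_bij[OF permutes_inv[OF u]]
    by (simp add: o_inv_distrib bij_comp comp_assoc)
  then have "inv (w0 n \<circ> inv u \<circ> w0 n) j = w0 n (?v j)"
    by (simp add: inv_w0 inv_inv_eq[OF permutes_bij[OF u]])
  moreover have "?v j \<in> {1..n}"
    using j permutes_in_image[OF permutes_compose[OF w0_permutes u]] by blast
  then have "w0 n (?v j) = n + 1 - ?v j" "?v j \<le> n" by (rule w0_simps(1)) (use \<open>?v j \<in> {1..n}\<close> in simp)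
  ultimately show ?thesis by (simp add: perm_act_def rho_def)
qed

lemma stab_simple_refl:
  assumes u: "u permutes {1..n}" and w: "w permutes {1..n}" and i: "i \<in> {1..<n}" and desc: "w (Suc i) < w i"
  shows "M_op n u i (stab n u w) = (stab n u (w \<circ> simple_refl i) :: 'k::field ratfun)"
proof -
  let ?\<mu> = "perm_act (w0 n \<circ> inv u \<circ> w0 n) (rho n)"
  let ?v = "u \<circ> w0 n"
  define Z where "Z w = (partition_fun n tv u w (\<lambda>i. inverse (xv i)) (\<lambda>j. inverse ((yv \<circ> u) j)) :: 'k ratfun)" for w
  define A where "A w = ((- 1) ^ perm_length n ?v * qh powi (2 * int (perm_length n (w0 n)) - int (perm_length n w)) :: 'k ratfun)" for w
  define r where "r = (r_fun n (xv \<circ> inv ?v) (yv \<circ> u) :: 'k ratfun)"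
  have stab: "stab n u w = A w * r * Z w" for w by (simp add: stab_def A_def r_def Z_def)
  have v: "?v permutes {1..n}" by (rule permutes_compose[OF w0_permutes u])
  have "monomial n xv ?\<mu> * monomial n (xv \<circ> inv ?v) (rho n)
      = (monomial n xv (\<lambda>j. ?\<mu> j + (rho n \<circ> ?v) j) :: 'k ratfun)"
    unfolding monomial_comp_inv[OF v] by (rule monomial_mult) simp
  also have "\<dots> = monomial n xv (\<lambda>_. int n - 1)"
    unfolding monomial_def comp_apply by (intro prod.cong refl) (simp add: exponents_complementary[OF u, unfolded comp_apply])
  finally have "monomial n xv ?\<mu> * r = (- 1) ^ perm_length n (w0 n) * monomial n xv (\<lambda>_. int n - 1)
      * monomial n (yv \<circ> u) (\<lambda>i. - rho n i)"
    by (simp add: r_def r_fun_def mult_ac)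
  moreover have "swap_ratfun i (monomial n (yv \<circ> u) (\<lambda>i. - rho n i)) = (monomial n (yv \<circ> u) (\<lambda>i. - rho n i) :: 'k ratfun)"
    by (simp add: monomial_def swap_ratfun_hom)
  ultimately have "swap_ratfun i (monomial n xv ?\<mu> * r) = monomial n xv ?\<mu> * r"
    by (simp add: swap_ratfun_mult swap_ratfun_power swap_ratfun_minus swap_ratfun_monomial_const[OF i])
  moreover have "swap_ratfun i (A w) = A w" by (simp add: A_def swap_ratfun_hom)
  ultimately have sym: "swap_ratfun i (A w * (monomial n xv ?\<mu> * r)) = A w * (monomial n xv ?\<mu> * r)"
    by (simp only: swap_ratfun_mult)
  have "monomial n xv ?\<mu> * stab n u w = (A w * (monomial n xv ?\<mu> * r)) * Z w"
    by (simp add: stab mult_ac)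
  then have "M_op n u i (stab n u w)
    = qh * monomial n xv (\<lambda>j. - ?\<mu> j) * ((A w * (monomial n xv ?\<mu> * r)) * Z (w \<circ> simple_refl i))"
    using tau_bar_partition_fun[where 'k = 'k, OF u w i desc, folded Z_def]
    by (simp only: M_op_def Let_def tau_bar_mult_symmetric[OF sym])
  also have "\<dots> = (monomial n xv (\<lambda>j. - ?\<mu> j) * monomial n xv ?\<mu>) * (qh * A w) * r * Z (w \<circ> simple_refl i)"
    by (simp only: mult_ac)
  also have "monomial n xv (\<lambda>j. - ?\<mu> j) * monomial n xv ?\<mu> = (1 :: 'k ratfun)"
    by (subst monomial_mult) (simp_all add: monomial_def)
  also have "qh * A w = A (w \<circ> simple_refl i)"
  proof -
    have e: "2 * int (perm_length n (w0 n)) - int (perm_length n (w \<circ> simple_refl i))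
        = 1 + (2 * int (perm_length n (w0 n)) - int (perm_length n w))"
      using perm_length_descent[OF w i desc] by simp
    show ?thesis unfolding A_def e power_int_add[OF disjI1, OF qh_nonzero] by simp
  qed
  finally show ?thesis by (simp only: stab mult_1_left)
qed

section \<open>Characterization of the stab polynomials\<close>

definition staircase_pairs :: "nat \<Rightarrow> (nat \<times> nat) set" where
  "staircase_pairs n = {(i, j). i \<in> {1..n} \<and> j \<in> {1..n} \<and> i + j \<le> n}"

lemma staircase_pairs_eq_Sigma: "staircase_pairs n = Sigma {1..n} (\<lambda>i. {1..<n + 1 - i})"
  by (auto simp: staircase_pairs_def)

lemma finite_staircase_pairs [simp]: "finite (staircase_pairs n)"
  by (simp add: staircase_pairs_eq_Sigma)

text \<open>
  Row \<open>i\<close> is attached to the color that leaves it, which starts in column \<open>n + 1 - i\<close>. This turns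
  the crossings of the frozen state into pairs of columns.
\<close>

lemma bij_betw_staircase_pairs:
  "bij_betw (\<lambda>(i, j). (j, n + 1 - i)) {(i, j) \<in> staircase_pairs n. P j (n + 1 - i)}
    {(i, j). i \<in> {1..n} \<and> j \<in> {1..n} \<and> i < j \<and> P i j}"
proof (rule bij_betw_byWitness[where f' = "\<lambda>(i, j). (n + 1 - j, i)"])
  let ?f = "\<lambda>(i, j). (j, n + 1 - i)" and ?g = "\<lambda>(i, j). (n + 1 - j, i)"
  let ?A = "{(i, j) \<in> staircase_pairs n. P j (n + 1 - i)}"
  let ?B = "{(i, j). i \<in> {1..n} \<and> j \<in> {1..n} \<and> i < j \<and> P i j}"
  show "\<forall>p\<in>?A. ?g (?f p) = p"
  proof
    fix p assume "p \<in> ?A"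
    then obtain i j where "p = (i, j)" "i \<le> n" by (cases p) (simp add: staircase_pairs_def)
    then show "?g (?f p) = p" by simp
  qed
  show "\<forall>p\<in>?B. ?f (?g p) = p"
  proof
    fix p assume "p \<in> ?B"
    then obtain i j where "p = (i, j)" "j \<le> n" by (cases p) simp
    then show "?f (?g p) = p" by simp
  qed
  show "?f ` ?A \<subseteq> ?B"
  proof
    fix p assume "p \<in> ?f ` ?A"
    then obtain i j where p: "p = (j, n + 1 - i)" and ij: "i \<in> {1..n}" "j \<in> {1..n}" "i + j \<le> n"
      and P: "P j (n + 1 - i)"
      by (elim imageE) (simp add: staircase_pairs_def split: prod.splits)
    have "n + 1 - i \<in> {1..n}" "j < n + 1 - i" using ij by auto
    with ij(2) P show "p \<in> ?B" unfolding p mem_Collect_eq case_prod_conv by blast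
  qed
  show "?g ` ?B \<subseteq> ?A"
  proof
    fix p assume "p \<in> ?g ` ?B"
    then obtain i j where p: "p = (n + 1 - j, i)" and ij: "i \<in> {1..n}" "j \<in> {1..n}" "i < j"
      and P: "P i j"
      by (elim imageE) (simp split: prod.splits)
    have "n + 1 - j \<in> {1..n}" "n + 1 - j + i \<le> n" "n + 1 - (n + 1 - j) = j" using ij by auto
    then show "p \<in> ?A"
      using ij(1) P unfolding p staircase_pairs_def mem_Collect_eq case_prod_conv by metis
  qed
qed

lemma card_staircase_inversions:
  assumes "u permutes {1..n}"
  shows "(\<Sum>(i, j)\<in>staircase_pairs n. if u (n + 1 - i) < u j then 1 else 0) = perm_length n u"
proof -
  have "(\<Sum>(i, j)\<in>staircase_pairs n. if u (n + 1 - i) < u j then 1 else 0)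
      = card {(i, j) \<in> staircase_pairs n. u (n + 1 - i) < u j}"
  proof -
    have "(\<Sum>p\<in>staircase_pairs n. if u (n + 1 - fst p) < u (snd p) then 1 else 0)
      = card {p \<in> staircase_pairs n. u (n + 1 - fst p) < u (snd p)}"
      unfolding card_eq_sum by (rule sum.inter_filter[symmetric]) simp
    then show ?thesis by (simp only: case_prod_unfold prod.collapse)
  qed
  also have "\<dots> = card (inversion_set n u)"
    using bij_betw_same_card[OF bij_betw_staircase_pairs[of n "\<lambda>i j. u j < u i"]]
    by (simp add: inversion_set_def)
  finally show ?thesis by (simp add: perm_length_eq_card_inversion_set[OF assms])
qed

lemma card_staircase_pairs: "card (staircase_pairs n) = perm_length n (w0 n)"
  using bij_betw_same_card[OF bij_betw_staircase_pairs[of n "\<lambda>_ _. True"]]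
  by (simp add: perm_length_w0)

lemma prod_staircase_fst:
  fixes z :: "nat \<Rightarrow> 'a::field"
  shows "(\<Prod>(i, j)\<in>staircase_pairs n. z i) = inverse (monomial n z (\<lambda>i. - rho n i))"
proof -
  have "(\<Prod>(i, j)\<in>staircase_pairs n. z i) = (\<Prod>i\<in>{1..n}. \<Prod>j\<in>{1..<n + 1 - i}. z i)"
    unfolding staircase_pairs_eq_Sigma by (subst prod.Sigma) simp_all
  also have "\<dots> = (\<Prod>i\<in>{1..n}. inverse (z i powi - rho n i))"
  proof (intro prod.cong refl)
    fix i assume i: "i \<in> {1..n}"
    have "z i powi int (n - i) = z i ^ (n - i)" by (rule power_int_of_nat)
    moreover have "int (n - i) = rho n i" using i by (simp add: rho_def)
    ultimately show "(\<Prod>j\<in>{1..<n + 1 - i}. z i) = inverse (z i powi - rho n i)"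
      by (simp add: power_int_minus)
  qed
  finally show ?thesis by (simp add: monomial_def prod_inversef[symmetric] comp_def)
qed

lemma prod_staircase_snd:
  fixes z :: "nat \<Rightarrow> 'a::field"
  shows "(\<Prod>(i, j)\<in>staircase_pairs n. z j) = inverse (monomial n z (\<lambda>i. - rho n i))"
proof -
  have "(\<Prod>(i, j)\<in>staircase_pairs n. z j) = (\<Prod>(i, j)\<in>staircase_pairs n. z i)"
    by (rule prod.reindex_bij_witness[where i = prod.swap and j = prod.swap])
      (auto simp: staircase_pairs_def)
  then show ?thesis by (simp only: prod_staircase_fst)
qed

text \<open>
  Each crossing contributes \<open>1 - y / x = - (y / x) (1 - x / y)\<close>. The monomial \<open>\<Prod> y / x\<close> converts
  \<open>r(\<cdot>; y\<^sub>u)\<close> into \<open>r(\<cdot>; x)\<close>, and with \<open>\<ell>(w\<^sub>0) = \<ell>(u) + \<ell>(u w\<^sub>0)\<close> the signs and the powers of \<open>q\<close>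
  combine.
\<close>

lemma stab_reversed:
  assumes u: "u permutes {1..n}"
  shows "(stab n u (u \<circ> w0 n) :: 'k::field ratfun) =
    (- 1) ^ perm_length n u * qh ^ perm_length n (u \<circ> w0 n)
    * r_fun n (xv \<circ> inv (u \<circ> w0 n)) xv
    * (\<Prod>(i, j)\<in>staircase_pairs n. 1 - xv i / yv (u j))"
proof -
  let ?P = "staircase_pairs n"
  define K L N where "K = perm_length n u" and "L = perm_length n (u \<circ> w0 n)" and "N = perm_length n (w0 n)"
  have N: "N = K + L" using perm_length_comp_w0[OF u] by (simp add: K_def L_def N_def)
  define G :: "'k ratfun" where "G = (\<Prod>(i, j)\<in>?P. 1 - xv i / yv (u j))"
  define mx :: "'k ratfun" where "mx = monomial n xv (\<lambda>i. - rho n i)"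
  define my :: "'k ratfun" where "my = monomial n (yv \<circ> u) (\<lambda>i. - rho n i)"
  define D :: "'k ratfun" where "D = monomial n (xv \<circ> inv (u \<circ> w0 n)) (rho n)"
  have nz: "mx \<noteq> 0" "my \<noteq> 0" unfolding mx_def my_def by (rule monomial_nonzero, simp)+
  have "partition_fun n tv u (u \<circ> w0 n) (\<lambda>i. inverse (xv i)) (\<lambda>j. inverse ((yv \<circ> u) j))
    = (\<Prod>(i, j)\<in>?P. tv ^ (if u (n + 1 - i) < u j then 1 else 0) * (1 - inverse (xv i) / inverse ((yv \<circ> u) j)) :: 'k ratfun)"
    unfolding staircase_pairs_eq_Sigma partition_fun_reversed[OF tv_nonzero u]
    by (subst prod.Sigma) simp_all
  also have "\<dots> = (\<Prod>(i, j)\<in>?P. tv ^ (if u (n + 1 - i) < u j then 1 else 0)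
      * (- 1 * (inverse (xv i) * (yv (u j) * (1 - xv i / yv (u j))))))"
    by (intro prod.cong refl) (auto simp: field_simps)
  also have "\<dots> = (\<Prod>(i, j)\<in>?P. tv ^ (if u (n + 1 - i) < u j then 1 else 0))
      * ((\<Prod>(i, j)\<in>?P. - 1) * (inverse (\<Prod>(i, j)\<in>?P. xv i) * ((\<Prod>(i, j)\<in>?P. (yv \<circ> u) j) * G)))"
    by (simp only: G_def case_prod_unfold prod.distrib prod_inversef[symmetric] comp_def)
  also have "(\<Prod>(i, j)\<in>?P. tv ^ (if u (n + 1 - i) < u j then 1 else 0)) = (tv ^ K :: 'k ratfun)"
    unfolding K_def card_staircase_inversions[OF u, symmetric] power_sum by (simp only: case_prod_unfold)
  also have "(\<Prod>(i, j)\<in>?P. - 1) = ((- 1) ^ N :: 'k ratfun)"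
    by (simp add: case_prod_unfold card_staircase_pairs N_def)
  finally have Z: "partition_fun n tv u (u \<circ> w0 n) (\<lambda>i. inverse (xv i)) (\<lambda>j. inverse ((yv \<circ> u) j))
    = tv ^ K * ((- 1) ^ N * (mx * (inverse my * G)))"
    by (simp only: prod_staircase_fst prod_staircase_snd mx_def my_def inverse_inverse_eq)
  have q: "qh powi (2 * int N - int L) * tv ^ K = (qh ^ L :: 'k ratfun)"
  proof -
    have "2 * int N - int L = int (L + 2 * K)" by (simp add: N)
    then have "qh powi (2 * int N - int L) = (qh ^ (L + 2 * K) :: 'k ratfun)"
      by (simp only: power_int_of_nat)
    moreover have "tv ^ K = (inverse (qh ^ (2 * K)) :: 'k ratfun)"
      by (simp add: tv_def qv_def power_inverse power_mult)
    ultimately show ?thesis by (simp add: power_add)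
  qed
  have sign: "(- 1) ^ N * (- 1) ^ N = (1 :: 'k ratfun)" "(- 1) ^ L = ((- 1) ^ K * (- 1) ^ N :: 'k ratfun)"
    subgoal by (simp flip: power_mult_distrib)
    subgoal
    proof -
      have "(- 1) ^ K * (- 1) ^ K = (1 :: 'k ratfun)" by (simp flip: power_mult_distrib)
      then show ?thesis by (simp add: N power_add flip: mult.assoc)
    qed
    done
  have "stab n u (u \<circ> w0 n) = (- 1) ^ L * qh powi (2 * int N - int L)
      * ((- 1) ^ N * D * my) * (tv ^ K * ((- 1) ^ N * (mx * (inverse my * G))))"
    unfolding stab_def r_fun_def Z by (simp only: L_def N_def D_def my_def)
  also have "\<dots> = (- 1) ^ L * (qh powi (2 * int N - int L) * tv ^ K)
      * ((- 1) ^ N * (- 1) ^ N) * (my * inverse my) * (D * mx) * G"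
    by (simp only: mult_ac)
  also have "\<dots> = (- 1) ^ K * qh ^ L * ((- 1) ^ N * D * mx) * G"
    unfolding q sign(1) sign(2) right_inverse[OF nz(2)] by (simp only: mult_1_left mult_1_right mult_ac)
  finally show ?thesis by (simp add: r_fun_def K_def L_def N_def D_def mx_def G_def)
qed

text \<open>
  Right multiplication by simple reflections acts transitively.
\<close>

lemma comp_simple_refl_induct:
  assumes v: "v permutes {1..n}" and w: "w permutes {1..n}" and base: "P v"
    and step: "\<And>w i. w permutes {1..n} \<Longrightarrow> i \<in> {1..<n} \<Longrightarrow> P w \<Longrightarrow> P (w \<circ> simple_refl i)"
  shows "P w"
proof -
  have "inv v \<circ> w permutes {1..n}" by (rule permutes_compose[OF w permutes_inv[OF v]])
  then obtain "is" where "is": "set is \<subseteq> {1..<n}" "word_prod is = inv v \<circ> w"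
    using exists_reduced_word by blast
  have "v \<circ> word_prod is permutes {1..n} \<and> P (v \<circ> word_prod is)" using "is"(1)
  proof (induction "is" rule: rev_induct)
    case Nil
    show ?case unfolding word_prod_simps comp_id using v base by blast
  next
    case (snoc i "is")
    have sub: "i \<in> {1..<n}" "set is \<subseteq> {1..<n}" using snoc.prems by simp_all
    have i: "i \<in> {1..<n}" and IH: "v \<circ> word_prod is permutes {1..n}" "P (v \<circ> word_prod is)"
      using sub(1) snoc.IH[OF sub(2)] by blast+
    have e: "v \<circ> word_prod (is @ [i]) = v \<circ> word_prod is \<circ> simple_refl i"
      by (simp only: word_prod_append word_prod_simps comp_id comp_assoc)
    show ?case unfolding e
      using step[OF IH(1) i IH(2)] permutes_compose[OF simple_refl_permutes[OF i] IH(1)] by blast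
  qed
  moreover have "v \<circ> word_prod is = w"
    unfolding "is"(2) using permutes_inv_o(1)[OF v] by (simp add: comp_assoc[symmetric])
  ultimately show ?thesis by simp
qed

theorem proposition6p9:
  fixes n :: nat and u :: "nat \<Rightarrow> nat" and F :: "(nat \<Rightarrow> nat) \<Rightarrow> 'k::field ratfun"
  assumes "u permutes {1..n}"
  shows
    "(F (u \<circ> w0 n) =
        (- 1) ^ perm_length n u * qh ^ perm_length n (u \<circ> w0 n)
        * r_fun n (xv \<circ> inv (u \<circ> w0 n)) xv
        * (\<Prod>(i, j)\<in>{(i, j). i \<in> {1..n} \<and> j \<in> {1..n} \<and> i + j \<le> n}. 1 - xv i / yv (u j)))
     \<and> (\<forall>w i. w permutes {1..n} \<longrightarrow> i \<in> {1..<n} \<longrightarrow> bruhat_less n (w \<circ> simple_refl i) w \<longrightarrow>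
          F (w \<circ> simple_refl i) = M_op n u i (F w))
     \<longleftrightarrow> (\<forall>w. w permutes {1..n} \<longrightarrow> F w = stab n u w)"
  unfolding staircase_pairs_def[symmetric] stab_reversed[OF assms, symmetric]
proof (intro iffI conjI allI impI; (elim conjE)?)
  have v: "u \<circ> w0 n permutes {1..n}" by (rule permutes_compose[OF w0_permutes assms])
  fix w assume base: "F (u \<circ> w0 n) = stab n u (u \<circ> w0 n)"
    and rec: "\<forall>w i. w permutes {1..n} \<longrightarrow> i \<in> {1..<n} \<longrightarrow> bruhat_less n (w \<circ> simple_refl i) w \<longrightarrow>
        F (w \<circ> simple_refl i) = M_op n u i (F w)"
    and w: "w permutes {1..n}"
  show "F w = stab n u w"
  proof (rule comp_simple_refl_induct[OF v w])
    show "F (u \<circ> w0 n) = stab n u (u \<circ> w0 n)" by (rule base)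
    fix w i assume w: "w permutes {1..n}" and i: "i \<in> {1..<n}" and eq: "F w = stab n u w"
    let ?w = "w \<circ> simple_refl i"
    have ws: "?w permutes {1..n}" by (rule permutes_compose[OF simple_refl_permutes[OF i] w])
    have twice: "?w \<circ> simple_refl i = w" by (simp only: comp_assoc simple_refl_simps comp_id)
    from descent_or_ascent[OF w, of i] show "F ?w = stab n u ?w"
    proof
      assume desc: "w (Suc i) < w i"
      then have "F ?w = M_op n u i (F w)" using rec w i bruhat_less_simple_refl_iff[OF w i] by blast
      then show ?thesis using stab_simple_refl[OF assms w i desc, where 'k = 'k] eq by (simp only:)
    next
      assume "w i < w (Suc i)"
      then have desc: "?w (Suc i) < ?w i" by simp
      \<comment> \<open>Here the recursion goes upwards in length, so injectivity of the operator is used.\<close>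
      then have "F (?w \<circ> simple_refl i) = M_op n u i (F ?w)"
        using rec ws i bruhat_less_simple_refl_iff[OF ws i] by blast
      then have "M_op n u i (F ?w) = M_op n u i (stab n u ?w)"
        using stab_simple_refl[OF assms ws i desc, where 'k = 'k] eq by (simp only: twice)
      then show ?thesis by (rule M_op_cancel)
    qed
  qed
  next
  assume "\<forall>w. w permutes {1..n} \<longrightarrow> F w = stab n u w"
  then show "F (u \<circ> w0 n) = stab n u (u \<circ> w0 n)"
    using permutes_compose[OF w0_permutes assms] by blast
  next
  fix w i assume eq: "\<forall>w. w permutes {1..n} \<longrightarrow> F w = stab n u w" and w: "w permutes {1..n}"
    and i: "i \<in> {1..<n}" and less: "bruhat_less n (w \<circ> simple_refl i) w"
  have desc: "w (Suc i) < w i" using less bruhat_less_simple_refl_iff[OF w i] by blast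
  have "w \<circ> simple_refl i permutes {1..n}" by (rule permutes_compose[OF simple_refl_permutes[OF i] w])
  then show "F (w \<circ> simple_refl i) = M_op n u i (F w)"
    using eq w stab_simple_refl[OF assms w i desc, where 'k = 'k] by (simp only:)
qed

end
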